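(* In the AR($p$) observation model described in the context, let $\hat r^{b}(k)$ and $\hat r^{u}(k)$ be the biased and unbiased estimates of $r(k)$. For each $\bullet\in\{b,u\}$ put $$\hat{\mathbf r}^{\bullet}_p=[\hat r^{\bullet}(1),\ldots,\hat r^{\bullet}(p)]^{\mathsf T},\qquad \widehat{\mathbf R}^{\bullet}_p=\mathcal T\left(\hat r^{\bullet}(1-p),\ldots,\hat r^{\bullet}(p-1)\right),$$ and define the biased ($\bullet=b$) and unbiased ($\bullet=u$) estimators of the AR coefficients by $$\hat{\mathbf a}^{\bullet}_p=[\hat a^{\bullet}_1,\ldots,\hat a^{\bullet}_p]^{\mathsf T}=\left(\widehat{\mathbf R}^{\bullet}_p\right)^{-1}\hat{\mathbf r}^{\bullet}_p .$$ Then there is a positive constant $K''$ such that for every $i\in\{1,\ldots,p\}$ and every $\epsilon>0$, $$\mathbb P\left[\left|\hat a^{b}_i-a_i\right|>\epsilon\right]\le\frac{K''}{\epsilon^2N_rT},\qquad \mathbb P\left[\left|\hat a^{u}_i-a_i\right|>\epsilon\right]\le\frac{K''}{\epsilon^2N_r(T-|i|)} .$$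
   Context: Model. Fix an order $p\ge 1$, real coefficients $a_1,\ldots,a_p$, and known variances $\sigma_x^2>0$ and $\sigma_w^2\geq 0$, none of which depend on $N_r$ or $T$. For $n=0,\ldots,N_r-1$, the processes $(h_n(t))_{t\in\mathbb Z}$ are independent and identically distributed in $n$. Each is a zero-mean stationary circular complex Gaussian process satisfying the (causal) AR($p$) equation $$h_n(t)=a_1h_n(t-1)+\cdots+a_ph_n(t-p)+x_n(t),$$ where the $x_n(t)\sim\mathcal{CN}(0,\sigma_x^2)$ are i.i.d. in $n$ and $t$ and $x_n(t)$ is independent of the past $(h_n(s))_{s<t}$. The observations are $$\hat h_n(t)=h_n(t)+w_n(t),\qquad 0\le n\le N_r-1,\ 0\le t\le T-1,$$ where the $w_n(t)\sim\mathcal{CN}(0,\sigma_w^2)$ are i.i.d. and independent of all $h_n$. Here $\mathcal{CN}(0,\sigma^2)$ is the circular complex Gaussian law with mean $0$ and variance $\sigma^2$. The window length satisfies $T>p$, so that all estimates below are defined. Covariances. $r(k)=\sigma_x^{-2}\,\mathbb E[h_n(t)h_n(t-k)^*]$ (so $r(k)$ is real and even). It is assumed that $\sum_{k=1-T}^{T-1}|r(k)|\le K$ with $K$ a fixed positive constant as $T,N_r\to\infty$. For a finite sequence $c(1-m),\ldots,c(m-1)$, $\mathcal T(c(1-m),\ldots,c(m-1))$ denotes the $m\times m$ Toeplitz matrix with $(i,j)$ entry $c(i-j)$. With $\mathbf R_p=\mathcal T(r(1-p),\ldots,r(p-1))$, which is invertible, and $\mathbf r_p=[r(1),\ldots,r(p)]^{\mathsf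 T}$, the Yule-Walker equations give $[a_1,\ldots,a_p]^{\mathsf T}=\mathbf R_p^{-1}\mathbf r_p$. Standing regime. $N_r$ and $T$ are of the same order and tend to infinity with $N_r/T\to c$ for some $c\in(0,\infty)$; "constant" means a quantity not depending on $N_r$, $T$ or $\epsilon$. Estimates. $$\hat r^{b}(0)=\hat r^{u}(0)=\frac{1}{\sigma_x^2N_rT}\sum_{n=0}^{N_r-1}\sum_{t=0}^{T-1}|\hat h_n(t)|^2-\frac{\sigma_w^2}{\sigma_x^2},$$ and for $1\le|k|\le T-1$, $$\hat r^{b}(k)=\frac{1}{\sigma_x^2N_rT}\sum_{n=0}^{N_r-1}\sum_{t}\hat h_n(t+k)\hat h_n(t)^*,\qquad \hat r^{u}(k)=\frac{1}{\sigma_x^2N_r(T-|k|)}\sum_{n=0}^{N_r-1}\sum_{t}\hat h_n(t+k)\hat h_n(t)^*,$$ where the sums over $t$ run over $0\le t\le T-1$ with $0\le t+k\le T-1$.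
   Formalization: The bounds are shown for all ε in (0,ε₀], any ε₀, once N_r and T are large depending on ε₀ (K'' does not depend on ε₀); for every ε>0 at fixed N_r,T they fail when σ_w²>0, e.g. p=1, where r̂(0) has positive density at 0 and the tail is of order 1/ε. *)

theory Defs
  imports
    "HOL-Probability.Probability"
    "Jordan_Normal_Form.Gauss_Jordan_Elimination"
begin

(* The law CN(0,v): independent real and imaginary parts, each N(0,v/2).  Being an image of the
   standard normal law on R^2, it also makes sense for v = 0, where it is the point mass at 0. *)
definition circ_normal :: "real \<Rightarrow> complex measure" where
  "circ_normal v =
     distr (density lborel std_normal_density \<Otimes>\<^sub>M density lborel std_normal_density) borel
       (\<lambda>(u, u'). complex_of_real (sqrt (v / 2)) * Complex u u')"

(* Zero-mean circular (jointly) complex Gaussian: every finite complex linear combination is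
   CN(0,v) for some v \<ge> 0; the zero mean and the vanishing of the pseudo-covariances
   E[g(s) g(t)] are part of this. *)
definition circ_gaussian_process :: "'a measure \<Rightarrow> (int \<Rightarrow> 'a \<Rightarrow> complex) \<Rightarrow> bool" where
  "circ_gaussian_process M g \<longleftrightarrow>
     (\<forall>t. g t \<in> borel_measurable M) \<and>
     (\<forall>S b. finite S \<longrightarrow>
        (\<exists>v\<ge>0. distr M borel (\<lambda>\<omega>. \<Sum>t\<in>S. b t * g t \<omega>) = circ_normal v))"

definition process_law :: "'a measure \<Rightarrow> (int \<Rightarrow> 'a \<Rightarrow> complex) \<Rightarrow> (int \<Rightarrow> complex) measure" where
  "process_law M g = distr M (\<Pi>\<^sub>M t\<in>UNIV. borel) (\<lambda>\<omega> t. g t \<omega>)"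

definition stationary_process :: "'a measure \<Rightarrow> (int \<Rightarrow> 'a \<Rightarrow> complex) \<Rightarrow> bool" where
  "stationary_process M g \<longleftrightarrow> (\<forall>s. process_law M (\<lambda>t. g (t + s)) = process_law M g)"

(* vx and vw are the variances of the innovations x and of the observation noise w.
   The processes h n are given for all n; a sample of size N uses n < N. *)
locale ar_observation_model = prob_space M
  for M :: "'a measure" +
  fixes p :: nat and a :: "nat \<Rightarrow> real" and vx vw :: real
    and h x w :: "nat \<Rightarrow> int \<Rightarrow> 'a \<Rightarrow> complex"
  assumes p_pos: "p \<ge> 1"
    and vx_pos: "vx > 0"
    and vw_nonneg: "vw \<ge> 0"
    and h_gaussian: "circ_gaussian_process M (h n)"
    and h_stationary: "stationary_process M (h n)"
    and h_indep: "indep_vars (\<lambda>_. \<Pi>\<^sub>M t\<in>UNIV. borel) (\<lambda>n \<omega> t. h n t \<omega>) UNIV"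
    and h_ident: "process_law M (h n) = process_law M (h n')"
    and ar_equation:
      "AE \<omega> in M. h n t \<omega> = (\<Sum>k=1..p. complex_of_real (a k) * h n (t - int k) \<omega>) + x n t \<omega>"
    and x_law: "distr M borel (x n t) = circ_normal vx"
    and x_indep: "indep_vars (\<lambda>_. borel) (\<lambda>(n, t). x n t) UNIV"
    \<comment> \<open>The library's \<open>indep_var\<close> needs two variables of one type, so the single value
      \<open>x n t\<close> is presented as a function on \<open>{t}\<close>.\<close>
    and x_indep_past:
      "indep_var (\<Pi>\<^sub>M s\<in>{t}. borel) (\<lambda>\<omega>. \<lambda>s\<in>{t}. x n s \<omega>)
                 (\<Pi>\<^sub>M s\<in>{..<t}. borel) (\<lambda>\<omega>. \<lambda>s\<in>{..<t}. h n s \<omega>)"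
    and w_law: "t \<ge> 0 \<Longrightarrow> distr M borel (w n t) = circ_normal vw"
    and w_indep: "indep_vars (\<lambda>_. borel) (\<lambda>(n, t). w n t) (UNIV \<times> {0..})"
    and w_indep_h:
      "indep_var (\<Pi>\<^sub>M nt\<in>UNIV \<times> {0..}. borel) (\<lambda>\<omega>. \<lambda>(n, t)\<in>UNIV \<times> {0..}. w n t \<omega>)
                 (\<Pi>\<^sub>M nt\<in>UNIV. borel) (\<lambda>\<omega> (n, t). h n t \<omega>)"

(* The normalized autocovariance r(k); for a stationary g the base time 0 is immaterial. *)
definition autocov :: "'a measure \<Rightarrow> real \<Rightarrow> (int \<Rightarrow> 'a \<Rightarrow> complex) \<Rightarrow> int \<Rightarrow> complex" where
  "autocov M vx g k = (\<integral>\<omega>. g 0 \<omega> * cnj (g (- k) \<omega>) \<partial>M) / complex_of_real vx"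

definition toeplitz :: "nat \<Rightarrow> (int \<Rightarrow> complex) \<Rightarrow> complex mat" where
  "toeplitz m c = Matrix.mat m m (\<lambda>(i, j). c (int i - int j))"

definition lag_sum :: "nat \<Rightarrow> nat \<Rightarrow> (nat \<Rightarrow> int \<Rightarrow> complex) \<Rightarrow> int \<Rightarrow> complex" where
  "lag_sum N T y k =
     (\<Sum>n<N. \<Sum>t | 0 \<le> t \<and> t \<le> int T - 1 \<and> 0 \<le> t + k \<and> t + k \<le> int T - 1.
        y n (t + k) * cnj (y n t))"

definition r_zero :: "real \<Rightarrow> real \<Rightarrow> nat \<Rightarrow> nat \<Rightarrow> (nat \<Rightarrow> int \<Rightarrow> complex) \<Rightarrow> real" where
  "r_zero vx vw N T y =
     (\<Sum>n<N. \<Sum>t=0..int T - 1. (cmod (y n t))\<^sup>2) / (vx * real N * real T) - vw / vx"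

definition r_biased ::
    "real \<Rightarrow> real \<Rightarrow> nat \<Rightarrow> nat \<Rightarrow> (nat \<Rightarrow> int \<Rightarrow> complex) \<Rightarrow> int \<Rightarrow> complex" where
  "r_biased vx vw N T y k =
     (if k = 0 then complex_of_real (r_zero vx vw N T y)
      else lag_sum N T y k / complex_of_real (vx * real N * real T))"

definition r_unbiased ::
    "real \<Rightarrow> real \<Rightarrow> nat \<Rightarrow> nat \<Rightarrow> (nat \<Rightarrow> int \<Rightarrow> complex) \<Rightarrow> int \<Rightarrow> complex" where
  "r_unbiased vx vw N T y k =
     (if k = 0 then complex_of_real (r_zero vx vw N T y)
      else lag_sum N T y k / complex_of_real (vx * real N * (real T - \<bar>real_of_int k\<bar>)))"

(* The vector inverse(toeplitz p c) * [c(1),...,c(p)]; its i-th coordinate (1 \<le> i \<le> p) has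
   index i - 1.  The value for a singular matrix is a convention: for the estimates above with
   N \<ge> 1 and T > p the determinant is a nonzero polynomial in the nondegenerate Gaussian variables
   h n t, so that singularity is a null event. *)
definition yule_walker :: "nat \<Rightarrow> (int \<Rightarrow> complex) \<Rightarrow> complex Matrix.vec" where
  "yule_walker p c =
     (case mat_inverse (toeplitz p c) of
        Some B \<Rightarrow> B *\<^sub>v Matrix.vec p (\<lambda>i. c (int i + 1))
      | None \<Rightarrow> 0\<^sub>v p)"

definition ar_est_biased ::
    "nat \<Rightarrow> real \<Rightarrow> real \<Rightarrow> nat \<Rightarrow> nat \<Rightarrow> (nat \<Rightarrow> int \<Rightarrow> complex) \<Rightarrow> nat \<Rightarrow> complex" where
  "ar_est_biased p vx vw N T y i = vec_index (yule_walker p (r_biased vx vw N T y)) (i - 1)"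

definition ar_est_unbiased ::
    "nat \<Rightarrow> real \<Rightarrow> real \<Rightarrow> nat \<Rightarrow> nat \<Rightarrow> (nat \<Rightarrow> int \<Rightarrow> complex) \<Rightarrow> nat \<Rightarrow> complex" where
  "ar_est_unbiased p vx vw N T y i = vec_index (yule_walker p (r_unbiased vx vw N T y)) (i - 1)"

definition joint_regime :: "nat \<Rightarrow> real \<Rightarrow> (nat \<Rightarrow> nat) \<Rightarrow> (nat \<Rightarrow> nat) \<Rightarrow> bool" where
  "joint_regime p c N T \<longleftrightarrow>
     filterlim N at_top sequentially \<and> filterlim T at_top sequentially \<and>
     (\<lambda>m. real (N m) / real (T m)) \<longlonglongrightarrow> c \<and> (\<forall>m. T m > p)"

end

theory Submission
  imports Defs "Jordan_Normal_Form.Determinant"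
begin

text \<open>
  By the Yule-Walker equations the estimation error of the coefficients solves a linear system whose
  data are the errors \<open>E(k)\<close> of the estimates of \<open>r(k)\<close>, so it is at most
  \<open>C max |E(k)|\<close> as long as \<open>max |E(k)| \<le> \<delta>\<^sub>0\<close>. Wick's formula and the
  summability of \<open>r\<close> give \<open>E |E(k)|\<^sup>2 = O(1/(N T))\<close>, where the squared bias
  \<open>O(1/T\<^sup>2)\<close> is absorbed because \<open>N/T\<close> converges, and Chebyshev's inequality settles
  \<open>\<epsilon> \<le> C \<delta>\<^sub>0\<close>. For \<open>C \<delta>\<^sub>0 < \<epsilon> \<le> \<epsilon>\<^sub>0\<close> one needs
  \<open>P(|E(k)| > \<delta>\<^sub>0) = o(1/(N T))\<close>, since the constant must not depend on \<open>\<epsilon>\<^sub>0\<close>.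
  This follows from Markov's inequality for fourth moments: \<open>E(k)\<close> averages \<open>N\<close> independent
  variables with second moments \<open>O(1/T)\<close> and bounded fourth moments, so its fourth moment is
  \<open>O(1/N\<^sup>3 + 1/(N T)\<^sup>2 + 1/T\<^sup>4)\<close>.
\<close>

section \<open>Stability of the Yule-Walker equations\<close>

lemma sum_cmod_mult_mat_vec_le:
  assumes A: "A \<in> carrier_mat n n" and v: "v \<in> carrier_vec n"
    and bound: "\<And>i j. i < n \<Longrightarrow> j < n \<Longrightarrow> cmod (A $$ (i, j)) \<le> \<delta>"
  shows "(\<Sum>i<n. cmod (vec_index (A *\<^sub>v v) i)) \<le> real n * \<delta> * (\<Sum>i<n. cmod (vec_index v i))"
proof -
  have "cmod (vec_index (A *\<^sub>v v) i) \<le> \<delta> * (\<Sum>j<n. cmod (vec_index v j))" if "i < n" for i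
  proof -
    have "vec_index (A *\<^sub>v v) i = (\<Sum>j<n. A $$ (i, j) * vec_index v j)"
      using A v that by (simp add: scalar_prod_def lessThan_atLeast0)
    also have "cmod \<dots> \<le> (\<Sum>j<n. cmod (A $$ (i, j)) * cmod (vec_index v j))"
      by (rule order_trans[OF norm_sum]) (simp add: norm_mult)
    also have "\<dots> \<le> (\<Sum>j<n. \<delta> * cmod (vec_index v j))"
      using bound that by (intro sum_mono mult_right_mono) auto
    finally show ?thesis by (simp add: sum_distrib_left)
  qed
  then have "(\<Sum>i<n. cmod (vec_index (A *\<^sub>v v) i)) \<le> (\<Sum>i<n. \<delta> * (\<Sum>j<n. cmod (vec_index v j)))"
    by (intro sum_mono) auto
  then show ?thesis by simp
qed

lemma perturbed_matrix_lower_bound: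
  fixes R :: "complex mat"
  assumes R: "R \<in> carrier_mat n n" and inv: "invertible_mat R"
  obtains L \<delta>\<^sub>0 :: real where "L > 0" "\<delta>\<^sub>0 > 0"
    "\<And>A v. A \<in> carrier_mat n n \<Longrightarrow> v \<in> carrier_vec n \<Longrightarrow>
        (\<And>i j. i < n \<Longrightarrow> j < n \<Longrightarrow> cmod (A $$ (i, j) - R $$ (i, j)) \<le> \<delta>\<^sub>0) \<Longrightarrow>
        (\<Sum>i<n. cmod (vec_index v i)) \<le> L * (\<Sum>i<n. cmod (vec_index (A *\<^sub>v v) i))"
proof -
  obtain B where RB: "R * B = 1\<^sub>m (dim_row R)" and BR: "B * R = 1\<^sub>m (dim_row B)"
    using inv by (auto simp: invertible_mat_def inverts_mat_def)
  have B: "B \<in> carrier_mat n n"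
    using arg_cong[OF RB, of dim_col] arg_cong[OF BR, of dim_col] R by auto
  have BR: "B * R = 1\<^sub>m n" using BR B by simp
  define \<beta> where "\<beta> = 1 + (\<Sum>i<n. \<Sum>j<n. cmod (B $$ (i, j)))"
  have "\<beta> \<ge> 1" by (simp add: \<beta>_def sum_nonneg)
  have \<beta>: "cmod (B $$ (i, j)) \<le> \<beta>" if "i < n" "j < n" for i j
  proof -
    have "cmod (B $$ (i, j)) \<le> (\<Sum>j<n. cmod (B $$ (i, j)))"
      using that by (intro member_le_sum[where f = "\<lambda>j. cmod (B $$ (i, j))"]) auto
    also have "\<dots> \<le> (\<Sum>i<n. \<Sum>j<n. cmod (B $$ (i, j)))"
      using that
      by (intro member_le_sum[where f = "\<lambda>i. \<Sum>j<n. cmod (B $$ (i, j))"]) (auto intro: sum_nonneg)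
    finally show ?thesis by (simp add: \<beta>_def)
  qed
  define N where "N = real n + 1"
  have N: "N > 0" "real n \<le> N" by (auto simp: N_def)
  define \<delta>\<^sub>0 where "\<delta>\<^sub>0 = 1 / (2 * N * \<beta> * N)"
  have "\<delta>\<^sub>0 > 0" using N \<open>\<beta> \<ge> 1\<close> by (simp add: \<delta>\<^sub>0_def)
  have bound: "(\<Sum>i<n. cmod (vec_index v i)) \<le> 2 * N * \<beta> * (\<Sum>i<n. cmod (vec_index (A *\<^sub>v v) i))"
    if A: "A \<in> carrier_mat n n" and v: "v \<in> carrier_vec n"
      and close: "\<And>i j. i < n \<Longrightarrow> j < n \<Longrightarrow> cmod (A $$ (i, j) - R $$ (i, j)) \<le> \<delta>\<^sub>0" for A v
  proof -
    let ?s = "\<lambda>v. \<Sum>i<n. cmod (vec_index v i)"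
    have s_nonneg: "?s u \<ge> 0" for u by (simp add: sum_nonneg)
    have D: "R - A \<in> carrier_mat n n" using R A by auto
    have Rv: "R *\<^sub>v v = A *\<^sub>v v + (R - A) *\<^sub>v v"
      using A R v by (simp add: minus_mult_distrib_mat_vec)
        (intro eq_vecI; simp)
    have "v = B *\<^sub>v (R *\<^sub>v v)"
      using BR B R v by (simp flip: assoc_mult_mat_vec)
    then have "?s v = ?s (B *\<^sub>v (R *\<^sub>v v))" by simp
    also have "\<dots> \<le> real n * \<beta> * ?s (R *\<^sub>v v)"
      by (rule sum_cmod_mult_mat_vec_le[OF B _ \<beta>]) (use R v in auto)
    also have "\<dots> \<le> N * \<beta> * ?s (R *\<^sub>v v)"
      using N \<open>\<beta> \<ge> 1\<close> s_nonneg by (intro mult_right_mono) auto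
    also have "?s (R *\<^sub>v v) \<le> ?s (A *\<^sub>v v) + ?s ((R - A) *\<^sub>v v)"
      using A R v by (simp add: Rv sum.distrib[symmetric] norm_triangle_ineq sum_mono
          del: index_mult_mat_vec)
    also have "?s ((R - A) *\<^sub>v v) \<le> real n * \<delta>\<^sub>0 * ?s v"
      using close R A
      by (intro sum_cmod_mult_mat_vec_le[OF D v]) (auto simp: norm_minus_commute)
    also have "real n * \<delta>\<^sub>0 * ?s v \<le> N * \<delta>\<^sub>0 * ?s v"
      using N \<open>\<delta>\<^sub>0 > 0\<close> s_nonneg by (intro mult_right_mono) auto
    finally have "?s v \<le> N * \<beta> * (?s (A *\<^sub>v v) + N * \<delta>\<^sub>0 * ?s v)"
      using N \<open>\<beta> \<ge> 1\<close> by (simp add: mult_left_mono)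
    also have "\<dots> = N * \<beta> * ?s (A *\<^sub>v v) + ?s v / 2"
      using N \<open>\<beta> \<ge> 1\<close> by (simp add: \<delta>\<^sub>0_def field_simps)
    finally show ?thesis by (simp add: field_simps)
  qed
  show ?thesis
    by (rule that[of "2 * N * \<beta>" \<delta>\<^sub>0]) (use N \<open>\<beta> \<ge> 1\<close> \<open>\<delta>\<^sub>0 > 0\<close> bound in auto)
qed

lemma yule_walker_perturbation:
  assumes inv: "invertible_mat (toeplitz p r)"
    and yw: "\<And>k. k \<in> {1..p} \<Longrightarrow> r (int k) = (\<Sum>j=1..p. \<alpha> j * r (int k - int j))"
  obtains C \<delta>\<^sub>0 :: real where "C > 0" "\<delta>\<^sub>0 > 0"
    "\<And>c \<delta> i. \<delta> \<le> \<delta>\<^sub>0 \<Longrightarrow> (\<And>k. \<bar>k\<bar> \<le> int p \<Longrightarrow> cmod (c k - r k) \<le> \<delta>) \<Longrightarrow> i \<in> {1..p} \<Longrightarrow>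
        cmod (vec_index (yule_walker p c) (i - 1) - \<alpha> i) \<le> C * \<delta>"
proof -
  have carrier [simp]: "toeplitz p c \<in> carrier_mat p p" for c by (simp add: toeplitz_def)
  have dims [simp]: "dim_row (toeplitz p c) = p" "dim_col (toeplitz p c) = p" for c
    by (simp_all add: toeplitz_def)
  have entry: "toeplitz p c $$ (i, j) = c (int i - int j)" if "i < p" "j < p" for c i j
    using that by (simp add: toeplitz_def)
  obtain L \<delta>\<^sub>0 :: real where L: "L > 0" and \<delta>\<^sub>0: "\<delta>\<^sub>0 > 0"
    and low: "\<And>A v. A \<in> carrier_mat p p \<Longrightarrow> v \<in> carrier_vec p \<Longrightarrow>
        (\<And>i j. i < p \<Longrightarrow> j < p \<Longrightarrow> cmod (A $$ (i, j) - toeplitz p r $$ (i, j)) \<le> \<delta>\<^sub>0) \<Longrightarrow>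
        (\<Sum>i<p. cmod (vec_index v i)) \<le> L * (\<Sum>i<p. cmod (vec_index (A *\<^sub>v v) i))"
    using perturbed_matrix_lower_bound[OF carrier inv] by blast
  define S where "S = 1 + (\<Sum>j<p. cmod (\<alpha> (Suc j)))"
  define C where "C = L * (real p * S) + 1"
  have "S \<ge> 1" by (simp add: S_def sum_nonneg)
  have "C > 0" using L \<open>S \<ge> 1\<close> by (auto simp: C_def intro!: add_nonneg_pos)
  moreover have "cmod (vec_index (yule_walker p c) (i - 1) - \<alpha> i) \<le> C * \<delta>"
    if \<delta>: "\<delta> \<le> \<delta>\<^sub>0" and close: "\<And>k. \<bar>k\<bar> \<le> int p \<Longrightarrow> cmod (c k - r k) \<le> \<delta>"
      and i: "i \<in> {1..p}" for c \<delta> i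
  proof -
    let ?A = "toeplitz p c"
    define rh where "rh = Matrix.vec p (\<lambda>i. c (int i + 1))"
    define av where "av = Matrix.vec p (\<lambda>i. \<alpha> (Suc i))"
    have [simp]: "rh \<in> carrier_vec p" "av \<in> carrier_vec p" by (simp_all add: rh_def av_def)
    have "0 \<le> \<delta>" using close[of 0] norm_ge_zero by (metis abs_zero of_nat_0_le_iff order_trans)
    have low': "(\<Sum>i<p. cmod (vec_index v i)) \<le> L * (\<Sum>i<p. cmod (vec_index (?A *\<^sub>v v) i))"
      if "v \<in> carrier_vec p" for v
    proof (rule low[OF carrier that])
      fix i j assume "i < p" "j < p"
      then have "cmod (c (int i - int j) - r (int i - int j)) \<le> \<delta>" by (intro close) auto
      with \<open>i < p\<close> \<open>j < p\<close> \<delta> show "cmod (?A $$ (i, j) - toeplitz p r $$ (i, j)) \<le> \<delta>\<^sub>0"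
        by (simp add: entry)
    qed
    have "Determinant.det ?A \<noteq> 0"
    proof
      assume "Determinant.det ?A = 0"
      then obtain v where v: "v \<in> carrier_vec p" "v \<noteq> 0\<^sub>v p" "?A *\<^sub>v v = 0\<^sub>v p"
        using det_0_iff_vec_prod_zero[OF carrier] by blast
      then have "(\<Sum>i<p. cmod (vec_index v i)) \<le> 0" using low'[of v] by simp
      then have "(\<Sum>i<p. cmod (vec_index v i)) = 0" by (simp add: antisym sum_nonneg)
      then have "\<forall>i<p. vec_index v i = 0" by (simp add: sum_nonneg_eq_0_iff)
      then have "v = 0\<^sub>v p" using v(1) by (intro eq_vecI) auto
      with v(2) show False by simp
    qed
    then have "?A \<in> Units (ring_mat TYPE(complex) p ())"
      by (rule det_non_zero_imp_unit[OF carrier])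
    then obtain B where some: "mat_inverse ?A = Some B"
      using mat_inverse(1)[OF carrier, of c "()"] by (cases "mat_inverse ?A") auto
    from mat_inverse(2)[OF carrier some] have B: "?A * B = 1\<^sub>m p" "B \<in> carrier_mat p p" by auto
    define u where "u = B *\<^sub>v rh"
    have yw_u: "yule_walker p c = u" by (simp add: yule_walker_def some u_def rh_def)
    have u [simp]: "u \<in> carrier_vec p" using B by (simp add: u_def)
    have Au: "?A *\<^sub>v u = rh"
      using B assoc_mult_mat_vec[OF carrier B(2), of rh c] by (simp add: u_def)
    have err: "cmod (vec_index (?A *\<^sub>v (u - av)) m) \<le> \<delta> * S" if m: "m < p" for m
    proof -
      have "vec_index (?A *\<^sub>v (u - av)) m = c (int m + 1) - (\<Sum>j<p. c (int m - int j) * \<alpha> (Suc j))"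
      proof -
        have "?A *\<^sub>v (u - av) = rh - ?A *\<^sub>v av"
          using Au mult_minus_distrib_mat_vec[OF carrier u, of av c] by simp
        then show ?thesis
          using m by (simp add: rh_def av_def scalar_prod_def lessThan_atLeast0 entry)
      qed
      also have "\<dots> = (c (int m + 1) - r (int m + 1)) -
          (\<Sum>j<p. (c (int m - int j) - r (int m - int j)) * \<alpha> (Suc j))"
      proof -
        have "r (int m + 1) = (\<Sum>j=1..p. \<alpha> j * r (int (Suc m) - int j))"
          using yw[of "Suc m"] m by (simp add: add.commute)
        also have "\<dots> = (\<Sum>j<p. r (int m - int j) * \<alpha> (Suc j))"
          by (rule sum.reindex_bij_witness[of _ Suc "\<lambda>j. j - 1"]) (auto simp: algebra_simps)
        finally show ?thesis by (simp add: left_diff_distrib sum_subtractf)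
      qed
      also have "cmod \<dots> \<le> \<delta> + (\<Sum>j<p. \<delta> * cmod (\<alpha> (Suc j)))"
        using m by (intro order_trans[OF norm_triangle_ineq4] add_mono close order_trans[OF norm_sum] sum_mono)
          (auto simp: norm_mult intro!: mult_right_mono close)
      finally show ?thesis by (simp add: S_def algebra_simps sum_distrib_left)
    qed
    have "cmod (vec_index u (i - 1) - \<alpha> i) = cmod (vec_index (u - av) (i - 1))"
      using i by (cases i) (simp_all add: av_def)
    also have "\<dots> \<le> (\<Sum>m<p. cmod (vec_index (u - av) m))"
      using i by (intro member_le_sum[where f = "\<lambda>m. cmod (vec_index (u - av) m)"]) auto
    also have "\<dots> \<le> L * (\<Sum>m<p. cmod (vec_index (?A *\<^sub>v (u - av)) m))"
      by (rule low') simp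
    also have "\<dots> \<le> L * (\<Sum>m<p. \<delta> * S)"
      using L err by (intro mult_left_mono sum_mono) auto
    also have "\<dots> \<le> C * \<delta>" using \<open>0 \<le> \<delta>\<close> by (simp add: C_def algebra_simps)
    finally show ?thesis by (simp add: yw_u)
  qed
  ultimately show ?thesis using \<delta>\<^sub>0 that[of C \<delta>\<^sub>0] by blast
qed

section \<open>Moments of circular complex normal variables\<close>

lemma
  fixes i j :: nat
  defines "N \<equiv> density lborel (\<lambda>x. ennreal (std_normal_density x))"
    and "m \<equiv> \<lambda>k. LINT x|lborel. std_normal_density x * x ^ k"
  shows integrable_std_normal_pair: "integrable (N \<Otimes>\<^sub>M N) (\<lambda>z. fst z ^ i * snd z ^ j)"
    and integral_std_normal_pair: "(LINT z|(N \<Otimes>\<^sub>M N). fst z ^ i * snd z ^ j) = m i * m j"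
proof -
  interpret N: prob_space N
    unfolding N_def by (rule prob_space_normal_density) simp
  interpret NN: pair_prob_space N N ..
  have [measurable_cong, simp]: "sets N = sets borel" by (simp add: N_def)
  have [simp]: "space N = UNIV" by (simp add: N_def)
  have int: "integrable N (\<lambda>x. x ^ k)" for k
    unfolding N_def using integrable_std_normal_moment[of k]
    by (subst integrable_density) auto
  have val: "(LINT x|N. x ^ k) = m k" for k
    unfolding N_def m_def by (subst integral_density) auto
  have f: "distr (N \<Otimes>\<^sub>M N) borel fst = N"
    by (metis N.distr_pair_fst \<open>sets N = sets borel\<close> distr_cong)
  have s: "distr (N \<Otimes>\<^sub>M N) borel snd = N"
  proof -
    have "distr (N \<Otimes>\<^sub>M N) N snd = N"
    proof (rule measure_eqI)
      fix A assume A: "A \<in> sets (distr (N \<Otimes>\<^sub>M N) N snd)"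
      then have "snd -` A \<inter> space (N \<Otimes>\<^sub>M N) = space N \<times> A"
        using sets.sets_into_space[of A N] by (auto simp: space_pair_measure)
      with A show "emeasure (distr (N \<Otimes>\<^sub>M N) N snd) A = emeasure N A"
        by (simp add: emeasure_distr N.emeasure_pair_measure_Times N.emeasure_space_1[simplified])
    qed simp
    then show ?thesis by (metis \<open>sets N = sets borel\<close> distr_cong)
  qed
  have "NN.indep_var borel fst borel snd"
    unfolding NN.indep_var_distribution_eq
  proof (intro conjI)
    have "distr (N \<Otimes>\<^sub>M N) (borel \<Otimes>\<^sub>M borel) (\<lambda>x. (fst x, snd x)) = distr (N \<Otimes>\<^sub>M N) (N \<Otimes>\<^sub>M N) (\<lambda>x. x)"
      by (intro distr_cong sets_pair_measure_cong) auto
    then show "distr (N \<Otimes>\<^sub>M N) borel fst \<Otimes>\<^sub>M distr (N \<Otimes>\<^sub>M N) borel snd =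
        distr (N \<Otimes>\<^sub>M N) (borel \<Otimes>\<^sub>M borel) (\<lambda>x. (fst x, snd x))"
      by (simp add: f s distr_id2)
  qed measurable
  then have ind: "NN.indep_var borel (\<lambda>z. fst z ^ i) borel (\<lambda>z. snd z ^ j)"
    using NN.indep_var_compose[of borel fst borel snd "\<lambda>x. x ^ i" borel "\<lambda>x. x ^ j" borel]
    by (simp add: comp_def)
  have int1: "integrable (N \<Otimes>\<^sub>M N) (\<lambda>z. fst z ^ k)" and val1: "(LINT z|(N \<Otimes>\<^sub>M N). fst z ^ k) = m k" for k
    using int[of k] val[of k] integrable_distr_eq[of fst "N \<Otimes>\<^sub>M N" borel "\<lambda>x. x ^ k"]
      integral_distr[of fst "N \<Otimes>\<^sub>M N" borel "\<lambda>x. x ^ k"] by (simp_all add: f)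
  have int2: "integrable (N \<Otimes>\<^sub>M N) (\<lambda>z. snd z ^ k)" and val2: "(LINT z|(N \<Otimes>\<^sub>M N). snd z ^ k) = m k" for k
    using int[of k] val[of k] integrable_distr_eq[of snd "N \<Otimes>\<^sub>M N" borel "\<lambda>x. x ^ k"]
      integral_distr[of snd "N \<Otimes>\<^sub>M N" borel "\<lambda>x. x ^ k"] by (simp_all add: s)
  show "integrable (N \<Otimes>\<^sub>M N) (\<lambda>z. fst z ^ i * snd z ^ j)"
    by (rule NN.indep_var_integrable[OF ind int1 int2])
  show "(LINT z|(N \<Otimes>\<^sub>M N). fst z ^ i * snd z ^ j) = m i * m j"
    by (simp add: NN.indep_var_lebesgue_integral[OF ind int1 int2] val1 val2)
qed

lemma
  assumes "v \<ge> 0"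
  shows integrable_circ_normal_power: "integrable (circ_normal v) (\<lambda>z. cmod z ^ (2 * k))"
    and circ_normal_mean: "(LINT z|circ_normal v. z) = 0"
    and circ_normal_pseudo_variance: "(LINT z|circ_normal v. z\<^sup>2) = 0"
    and circ_normal_variance: "(LINT z|circ_normal v. (cmod z)\<^sup>2) = v"
    and circ_normal_moment4: "(LINT z|circ_normal v. cmod z ^ 4) = 2 * v\<^sup>2"
proof -
  define N where "N = density lborel (\<lambda>x. ennreal (std_normal_density x))"
  define m where "m = (\<lambda>k. LINT x|lborel. std_normal_density x * x ^ k)"
  define q where "q = (\<lambda>z. complex_of_real (sqrt (v / 2)) * Complex (fst z) (snd z))"
  have [measurable_cong, simp]: "sets N = sets borel" by (simp add: N_def)
  have I: "integrable (N \<Otimes>\<^sub>M N) (\<lambda>z. fst z ^ i * snd z ^ j)" for i j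
    using integrable_std_normal_pair[of i j] by (simp add: N_def)
  have E: "(LINT z|(N \<Otimes>\<^sub>M N). fst z ^ i * snd z ^ j) = m i * m j" for i j
    using integral_std_normal_pair[of i j] by (simp add: N_def m_def)
  have m: "m 0 = 1" "m (Suc 0) = 0" "m 2 = 1" "m 4 = 3"
    using integral_std_normal_moment_even[of 0] integral_std_normal_moment_even[of 1]
      integral_std_normal_moment_even[of 2] integral_std_normal_moment_odd[of 0]
    by (simp_all add: m_def fact_numeral)
  have q: "q z = complex_of_real (sqrt (v / 2)) * (complex_of_real (fst z) + \<i> * complex_of_real (snd z))" for z
    by (simp add: q_def complex_eq_iff)
  have [measurable]: "q \<in> borel_measurable (N \<Otimes>\<^sub>M N)"
    unfolding q by measurable
  have circ: "circ_normal v = distr (N \<Otimes>\<^sub>M N) borel q"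
    unfolding circ_normal_def N_def q_def by (simp add: case_prod_unfold)
  have sq: "(cmod (q z))\<^sup>2 = v / 2 * ((fst z)\<^sup>2 + (snd z)\<^sup>2)" for z
    using assms by (simp add: q_def norm_mult power_mult_distrib cmod_power2)
  have "integrable (N \<Otimes>\<^sub>M N) (\<lambda>z. (v / 2) ^ k * (\<Sum>i\<le>k. real (k choose i) * (fst z ^ (2 * i) * snd z ^ (2 * (k - i)))))"
    using I by (intro integrable_mult_right integrable_sum) auto
  also have "(\<lambda>z. (v / 2) ^ k * (\<Sum>i\<le>k. real (k choose i) * (fst z ^ (2 * i) * snd z ^ (2 * (k - i))))) =
      (\<lambda>z. cmod (q z) ^ (2 * k))"
    by (simp add: power_mult sq power_mult_distrib power_divide binomial_ring mult.assoc)
  finally show "integrable (circ_normal v) (\<lambda>z. cmod z ^ (2 * k))"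
    unfolding circ by (subst integrable_distr_eq) auto
  have c1: "integrable (N \<Otimes>\<^sub>M N) (\<lambda>z. complex_of_real (fst z))"
    "integrable (N \<Otimes>\<^sub>M N) (\<lambda>z. complex_of_real (snd z))"
    using I[of 1 0] I[of 0 1] by auto
  show "(LINT z|circ_normal v. z) = 0"
    unfolding circ using c1 E[of 1 0] E[of 0 1]
    by (subst integral_distr) (auto simp: ext[OF q] m)
  have q2: "(q z)\<^sup>2 = complex_of_real (v / 2) *
      (complex_of_real ((fst z)\<^sup>2) - complex_of_real ((snd z)\<^sup>2) + 2 * \<i> * complex_of_real (fst z * snd z))" for z
  proof -
    have "(complex_of_real (sqrt (v / 2)))\<^sup>2 = complex_of_real (v / 2)"
      using assms by (metis of_real_power divide_nonneg_nonneg real_sqrt_pow2 zero_le_numeral)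
    then show ?thesis
      unfolding q power_mult_distrib by (simp only:) (simp add: power2_eq_square algebra_simps)
  qed
  show "(LINT z|circ_normal v. z\<^sup>2) = 0"
    unfolding circ using I[of 2 0] I[of 0 2] I[of 1 1] E[of 2 0] E[of 0 2] E[of 1 1]
    by (subst integral_distr) (auto simp: q2 m simp del: of_real_mult of_real_power of_real_divide)
  show "(LINT z|circ_normal v. (cmod z)\<^sup>2) = v"
    unfolding circ using I[of 2 0] I[of 0 2] E[of 2 0] E[of 0 2]
    by (subst integral_distr) (auto simp: sq m)
  have q4: "cmod (q z) ^ 4 = v\<^sup>2 / 4 * (fst z ^ 4 + 2 * ((fst z)\<^sup>2 * (snd z)\<^sup>2) + snd z ^ 4)" for z
  proof -
    have "cmod (q z) ^ 4 = ((cmod (q z))\<^sup>2)\<^sup>2" by simp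
    then show ?thesis unfolding sq by (simp add: power2_eq_square power4_eq_xxxx algebra_simps)
  qed
  show "(LINT z|circ_normal v. cmod z ^ 4) = 2 * v\<^sup>2"
    unfolding circ using I[of 4 0] I[of 0 4] I[of 2 2] E[of 4 0] E[of 0 4] E[of 2 2]
    by (subst integral_distr) (auto simp: q4 m)
qed

text \<open>Moment consequences of circular complex normality that suffice below. Unlike for normality itself,
  closure under sums of independent variables is a direct computation.\<close>

definition (in prob_space) circular_quartic :: "('a \<Rightarrow> complex) \<Rightarrow> bool" where
  "circular_quartic Z \<longleftrightarrow> Z \<in> borel_measurable M \<and> integrable M (\<lambda>\<omega>. cmod (Z \<omega>) ^ 8) \<and>
     expectation Z = 0 \<and> expectation (\<lambda>\<omega>. (Z \<omega>)\<^sup>2) = 0 \<and>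
     expectation (\<lambda>\<omega>. cmod (Z \<omega>) ^ 4) = 2 * (expectation (\<lambda>\<omega>. (cmod (Z \<omega>))\<^sup>2))\<^sup>2"

lemma borel_measurable_cnj [measurable]: "cnj \<in> borel_measurable borel"
  by (intro borel_measurable_continuous_onI continuous_intros)

lemma power_le_one_plus_power:
  fixes x :: real
  assumes "0 \<le> x" "k \<le> n"
  shows "x ^ k \<le> 1 + x ^ n"
proof (cases "x \<le> 1")
  case True
  then have "x ^ k \<le> 1" using assms by (simp add: power_le_one)
  with assms show ?thesis by (simp add: add_increasing2)
next
  case False
  then have "x ^ k \<le> x ^ n" using assms by (intro power_increasing) auto
  then show ?thesis by simp
qed

lemma power_add_le:
  fixes x y :: real
  assumes "0 \<le> x" "0 \<le> y"
  shows "(x + y) ^ n \<le> 2 ^ n * (x ^ n + y ^ n)"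
proof -
  have "(x + y) ^ n \<le> (2 * max x y) ^ n" using assms by (intro power_mono) auto
  also have "\<dots> \<le> 2 ^ n * (x ^ n + y ^ n)" using assms by (auto simp: power_mult_distrib max_def)
  finally show ?thesis .
qed

context prob_space
begin

lemma integrable_lower_power:
  fixes Z :: "'a \<Rightarrow> 'b::{banach, second_countable_topology}"
  assumes [measurable]: "Z \<in> borel_measurable M" and "integrable M (\<lambda>\<omega>. norm (Z \<omega>) ^ n)" "k \<le> n"
  shows "integrable M (\<lambda>\<omega>. norm (Z \<omega>) ^ k)"
  by (rule Bochner_Integration.integrable_bound[of M "\<lambda>\<omega>. 1 + norm (Z \<omega>) ^ n"])
    (use assms in \<open>auto simp: power_le_one_plus_power\<close>)

lemma circular_quarticD:
  assumes "circular_quartic Z"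
  shows circular_quartic_measurable: "Z \<in> borel_measurable M"
    and circular_quartic_integrable_norm_power: "k \<le> 8 \<Longrightarrow> integrable M (\<lambda>\<omega>. cmod (Z \<omega>) ^ k)"
    and circular_quartic_integrable: "integrable M Z"
    and circular_quartic_integrable_power2: "integrable M (\<lambda>\<omega>. (Z \<omega>)\<^sup>2)"
    and circular_quartic_mean: "expectation Z = 0"
    and circular_quartic_pseudo_variance: "expectation (\<lambda>\<omega>. (Z \<omega>)\<^sup>2) = 0"
    and circular_quartic_moment4:
      "expectation (\<lambda>\<omega>. cmod (Z \<omega>) ^ 4) = 2 * (expectation (\<lambda>\<omega>. (cmod (Z \<omega>))\<^sup>2))\<^sup>2"
proof -
  show Z [measurable]: "Z \<in> borel_measurable M" using assms by (simp add: circular_quartic_def)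
  show int: "integrable M (\<lambda>\<omega>. cmod (Z \<omega>) ^ k)" if "k \<le> 8" for k
    using assms that by (auto simp: circular_quartic_def intro: integrable_lower_power[OF Z, of 8])
  show "integrable M Z"
    by (rule iffD1[OF integrable_norm_iff]) (use int[of 1] in auto)
  show "integrable M (\<lambda>\<omega>. (Z \<omega>)\<^sup>2)"
    by (rule iffD1[OF integrable_norm_iff]) (use int[of 2] in \<open>auto simp: norm_power\<close>)
qed (use assms in \<open>auto simp: circular_quartic_def\<close>)

lemma circular_quartic_circ_normal:
  assumes [measurable]: "Z \<in> borel_measurable M" and law: "distr M borel Z = circ_normal v" and "v \<ge> 0"
  shows "circular_quartic Z"
    and "expectation (\<lambda>\<omega>. (cmod (Z \<omega>))\<^sup>2) = v"
proof -
  have E: "expectation (\<lambda>\<omega>. f (Z \<omega>)) = (LINT z|circ_normal v. f z)"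
    if [measurable]: "f \<in> borel_measurable borel" for f :: "complex \<Rightarrow> 'b::{banach, second_countable_topology}"
    by (simp flip: law add: integral_distr)
  show var: "expectation (\<lambda>\<omega>. (cmod (Z \<omega>))\<^sup>2) = v"
    using \<open>v \<ge> 0\<close> by (subst E) (auto simp: circ_normal_variance)
  have "integrable (distr M borel Z) (\<lambda>z. cmod z ^ 8)"
    using integrable_circ_normal_power[OF \<open>v \<ge> 0\<close>, of 4] by (simp add: law)
  then have "integrable M (\<lambda>\<omega>. cmod (Z \<omega>) ^ 8)"
    by (subst (asm) integrable_distr_eq) auto
  moreover have "expectation Z = 0"
    using E[of "\<lambda>z. z"] \<open>v \<ge> 0\<close> by (simp add: circ_normal_mean)
  moreover have "expectation (\<lambda>\<omega>. (Z \<omega>)\<^sup>2) = 0"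
    using \<open>v \<ge> 0\<close> by (subst E) (auto simp: circ_normal_pseudo_variance)
  moreover have "expectation (\<lambda>\<omega>. cmod (Z \<omega>) ^ 4) = 2 * v\<^sup>2"
    using \<open>v \<ge> 0\<close> by (subst E) (auto simp: circ_normal_moment4)
  ultimately show "circular_quartic Z"
    by (simp add: circular_quartic_def var)
qed

lemma circular_quartic_mult:
  assumes "circular_quartic Z"
  shows "circular_quartic (\<lambda>\<omega>. b * Z \<omega>)"
  using assms by (auto simp: circular_quartic_def norm_mult power_mult_distrib)

lemma circular_quartic_zero: "circular_quartic (\<lambda>_. 0)"
  by (simp add: circular_quartic_def)

lemma
  fixes f :: "'b \<Rightarrow> 'd::{real_normed_field, banach, second_countable_topology}"
  assumes ind: "indep_var S X T Y"
    and [measurable]: "f \<in> borel_measurable S" "g \<in> borel_measurable T"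
    and int: "integrable M (\<lambda>\<omega>. f (X \<omega>))" "integrable M (\<lambda>\<omega>. g (Y \<omega>))"
  shows indep_var_expectation_mult:
      "expectation (\<lambda>\<omega>. f (X \<omega>) * g (Y \<omega>)) = expectation (\<lambda>\<omega>. f (X \<omega>)) * expectation (\<lambda>\<omega>. g (Y \<omega>))"
    and indep_var_integrable_mult: "integrable M (\<lambda>\<omega>. f (X \<omega>) * g (Y \<omega>))"
proof -
  have "indep_var borel (\<lambda>\<omega>. f (X \<omega>)) borel (\<lambda>\<omega>. g (Y \<omega>))"
    using indep_var_compose[OF ind, of f borel g borel] by (simp add: comp_def)
  from indep_var_lebesgue_integral[OF this int] indep_var_integrable[OF this int]
  show "expectation (\<lambda>\<omega>. f (X \<omega>) * g (Y \<omega>)) = expectation (\<lambda>\<omega>. f (X \<omega>)) * expectation (\<lambda>\<omega>. g (Y \<omega>))"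
    "integrable M (\<lambda>\<omega>. f (X \<omega>) * g (Y \<omega>))" by auto
qed

lemma circular_quartic_add:
  assumes 1: "circular_quartic Z" and 2: "circular_quartic W" and ind: "indep_var borel Z borel W"
  shows "circular_quartic (\<lambda>\<omega>. Z \<omega> + W \<omega>)"
proof -
  note [measurable] = circular_quartic_measurable[OF 1] circular_quartic_measurable[OF 2]
  note int = circular_quartic_integrable_norm_power[OF 1] circular_quartic_integrable_norm_power[OF 2]
  note intc = circular_quartic_integrable[OF 1] circular_quartic_integrable[OF 2]
    circular_quartic_integrable_power2[OF 1] circular_quartic_integrable_power2[OF 2]
  note zero = circular_quartic_mean[OF 1] circular_quartic_mean[OF 2]
    circular_quartic_pseudo_variance[OF 1] circular_quartic_pseudo_variance[OF 2]
  define vZ where "vZ = expectation (\<lambda>\<omega>. (cmod (Z \<omega>))\<^sup>2)"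
  define vW where "vW = expectation (\<lambda>\<omega>. (cmod (W \<omega>))\<^sup>2)"
  have int3: "integrable M (\<lambda>\<omega>. (cmod (Z \<omega>))\<^sup>2 * Z \<omega>)"
    by (subst integrable_norm_iff[symmetric])
      (use int(1)[of 3] in \<open>auto simp: norm_mult norm_power power3_eq_cube power2_eq_square\<close>)
  have int3': "integrable M (\<lambda>\<omega>. (cmod (W \<omega>))\<^sup>2 * cnj (W \<omega>))"
    by (subst integrable_norm_iff[symmetric])
      (use int(2)[of 3] in \<open>auto simp: norm_mult norm_power power3_eq_cube power2_eq_square\<close>)
  note prod = indep_var_expectation_mult[OF ind] indep_var_integrable_mult[OF ind]
  have ZW: "expectation (\<lambda>\<omega>. Z \<omega> * W \<omega>) = 0" "integrable M (\<lambda>\<omega>. Z \<omega> * W \<omega>)"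
    using prod[of "\<lambda>z. z" "\<lambda>z. z"] intc zero by auto
  have Zcw: "expectation (\<lambda>\<omega>. Z \<omega> * cnj (W \<omega>)) = 0" "integrable M (\<lambda>\<omega>. Z \<omega> * cnj (W \<omega>))"
    using prod[of "\<lambda>z. z" "\<lambda>z. cnj z"] intc zero by auto
  have Z3: "expectation (\<lambda>\<omega>. ((cmod (Z \<omega>))\<^sup>2 * Z \<omega>) * cnj (W \<omega>)) = 0"
      "integrable M (\<lambda>\<omega>. ((cmod (Z \<omega>))\<^sup>2 * Z \<omega>) * cnj (W \<omega>))"
    using prod[of "\<lambda>z. (cmod z)\<^sup>2 * z" cnj] intc zero int3 int3' by auto
  have W3: "expectation (\<lambda>\<omega>. Z \<omega> * ((cmod (W \<omega>))\<^sup>2 * cnj (W \<omega>))) = 0"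
      "integrable M (\<lambda>\<omega>. Z \<omega> * ((cmod (W \<omega>))\<^sup>2 * cnj (W \<omega>)))"
    using prod[of "\<lambda>z. z" "\<lambda>z. (cmod z)\<^sup>2 * cnj z"] intc zero int3 int3' by auto
  have Z2W2: "expectation (\<lambda>\<omega>. (Z \<omega>)\<^sup>2 * cnj ((W \<omega>)\<^sup>2)) = 0" "integrable M (\<lambda>\<omega>. (Z \<omega>)\<^sup>2 * cnj ((W \<omega>)\<^sup>2))"
    using prod[of "\<lambda>z. z\<^sup>2" "\<lambda>z. cnj (z\<^sup>2)"] intc zero by (auto simp del: complex_cnj_power)
  have AB: "expectation (\<lambda>\<omega>. (cmod (Z \<omega>))\<^sup>2 * (cmod (W \<omega>))\<^sup>2) = vZ * vW"
      "integrable M (\<lambda>\<omega>. (cmod (Z \<omega>))\<^sup>2 * (cmod (W \<omega>))\<^sup>2)"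
    using prod[of "\<lambda>z. (cmod z)\<^sup>2" "\<lambda>z. (cmod z)\<^sup>2"] int by (auto simp: vZ_def vW_def)
  have sq: "(cmod (z + w))\<^sup>2 = (cmod z)\<^sup>2 + (cmod w)\<^sup>2 + 2 * Re (z * cnj w)" for z w :: complex
    by (simp only: cmod_power2) (simp add: power2_eq_square algebra_simps)
  have quart: "cmod (z + w) ^ 4 = cmod z ^ 4 + cmod w ^ 4 + 4 * ((cmod z)\<^sup>2 * (cmod w)\<^sup>2) +
      4 * Re (((cmod z)\<^sup>2 * z) * cnj w) + 4 * Re (z * ((cmod w)\<^sup>2 * cnj w)) + 2 * Re (z\<^sup>2 * cnj (w\<^sup>2))" for z w :: complex
  proof -
    define A B D where "A = (cmod z)\<^sup>2" and "B = (cmod w)\<^sup>2" and "D = Re (z * cnj w)"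
    have e: "cmod u ^ 4 = ((cmod u)\<^sup>2)\<^sup>2" for u by simp
    have "2 * (Re u)\<^sup>2 = (cmod u)\<^sup>2 + Re (u\<^sup>2)" for u
      unfolding cmod_power2 by (simp add: power2_eq_square)
    from this[of "z * cnj w"] have D2: "Re (z\<^sup>2 * cnj (w\<^sup>2)) = 2 * D\<^sup>2 - A * B"
      by (simp add: A_def B_def D_def norm_mult power_mult_distrib del: times_complex.sel)
    have r: "Re ((A * z) * cnj w) = A * D" "Re (z * (B * cnj w)) = B * D"
      by (simp_all add: D_def algebra_simps)
    show ?thesis unfolding e sq A_def[symmetric] B_def[symmetric] r D2 D_def[symmetric]
      by (simp add: power2_eq_square algebra_simps)
  qed
  have re: "expectation (\<lambda>\<omega>. Re (f \<omega>)) = 0" "integrable M (\<lambda>\<omega>. Re (f \<omega>))"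
    if "expectation f = 0" "integrable M f" for f :: "'a \<Rightarrow> complex"
    using that by simp_all
  have v: "expectation (\<lambda>\<omega>. (cmod (Z \<omega> + W \<omega>))\<^sup>2) = vZ + vW"
    unfolding sq using int(1)[of 2] int(2)[of 2] re[OF Zcw]
    by (simp add: vZ_def vW_def del: times_complex.sel)
  have "expectation (\<lambda>\<omega>. cmod (Z \<omega> + W \<omega>) ^ 4) = 2 * vZ\<^sup>2 + 2 * vW\<^sup>2 + 4 * (vZ * vW)"
    unfolding quart using int(1)[of 4] int(2)[of 4] AB re[OF Z3] re[OF W3] re[OF Z2W2]
      circular_quartic_moment4[OF 1] circular_quartic_moment4[OF 2]
    by (simp add: vZ_def vW_def del: complex_cnj_power times_complex.sel complex_cnj_mult)
  also have "\<dots> = 2 * (vZ + vW)\<^sup>2" by (simp add: power2_eq_square algebra_simps)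
  finally have 4: "expectation (\<lambda>\<omega>. cmod (Z \<omega> + W \<omega>) ^ 4) = 2 * (vZ + vW)\<^sup>2" .
  have 8: "integrable M (\<lambda>\<omega>. cmod (Z \<omega> + W \<omega>) ^ 8)"
  proof (rule Bochner_Integration.integrable_bound)
    show "integrable M (\<lambda>\<omega>. 2 ^ 8 * (cmod (Z \<omega>) ^ 8 + cmod (W \<omega>) ^ 8))"
      using int by (intro integrable_mult_right Bochner_Integration.integrable_add) auto
    show "AE \<omega> in M. norm (cmod (Z \<omega> + W \<omega>) ^ 8) \<le> norm (2 ^ 8 * (cmod (Z \<omega>) ^ 8 + cmod (W \<omega>) ^ 8))"
      by (rule AE_I2) (auto intro!: order_trans[OF power_mono[OF norm_triangle_ineq] power_add_le] simp del: power_numeral)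
  qed simp
  show ?thesis
    using 8 4 v zero intc ZW by (simp add: circular_quartic_def power2_sum mult.assoc)
qed

lemma integrable_mult_cnj:
  assumes "circular_quartic Z" "circular_quartic W"
  shows "integrable M (\<lambda>\<omega>. Z \<omega> * cnj (W \<omega>))"
proof (rule Bochner_Integration.integrable_bound)
  note [measurable] = assms[THEN circular_quartic_measurable]
  show "(\<lambda>\<omega>. Z \<omega> * cnj (W \<omega>)) \<in> borel_measurable M" by measurable
  show "integrable M (\<lambda>\<omega>. (cmod (Z \<omega>))\<^sup>2 + (cmod (W \<omega>))\<^sup>2)"
    using assms[THEN circular_quartic_integrable_norm_power] by simp
  have "a * b \<le> a\<^sup>2 + b\<^sup>2" for a b :: real
  proof -
    have "2 * (a * b) \<le> a\<^sup>2 + b\<^sup>2" using sum_squares_bound[of a b] by simp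
    moreover have "0 \<le> a\<^sup>2 + b\<^sup>2" by simp
    ultimately show ?thesis by linarith
  qed
  then show "AE \<omega> in M. norm (Z \<omega> * cnj (W \<omega>)) \<le> norm ((cmod (Z \<omega>))\<^sup>2 + (cmod (W \<omega>))\<^sup>2)"
    by (intro AE_I2) (simp add: norm_mult)
qed

lemma indep_var_covariance_eq_0:
  assumes ind: "indep_var borel Z borel W" and Z: "circular_quartic Z" and W: "circular_quartic W"
  shows "expectation (\<lambda>\<omega>. Z \<omega> * cnj (W \<omega>)) = 0" "expectation (\<lambda>\<omega>. W \<omega> * cnj (Z \<omega>)) = 0"
proof -
  note int = circular_quartic_integrable[OF Z] circular_quartic_integrable[OF W]
  have "expectation (\<lambda>\<omega>. Z \<omega> * cnj (W \<omega>)) = expectation Z * expectation (\<lambda>\<omega>. cnj (W \<omega>))"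
    by (rule indep_var_expectation_mult[OF ind, of "\<lambda>z. z" cnj]) (use int in auto)
  then show "expectation (\<lambda>\<omega>. Z \<omega> * cnj (W \<omega>)) = 0"
    unfolding circular_quartic_mean[OF Z] by simp
  have "(\<lambda>\<omega>. W \<omega> * cnj (Z \<omega>)) = (\<lambda>\<omega>. cnj (Z \<omega>) * W \<omega>)" by (simp add: fun_eq_iff)
  moreover have "expectation (\<lambda>\<omega>. cnj (Z \<omega>) * W \<omega>) = expectation (\<lambda>\<omega>. cnj (Z \<omega>)) * expectation W"
    by (rule indep_var_expectation_mult[OF ind, of cnj "\<lambda>z. z"]) (use int in auto)
  ultimately show "expectation (\<lambda>\<omega>. W \<omega> * cnj (Z \<omega>)) = 0"
    unfolding circular_quartic_mean[OF W] by simp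
qed

text \<open>Wick's formula for squared moduli, obtained by averaging the fourth moments of
  \<open>Z + u W\<close> over the fourth roots of unity \<open>u\<close>.\<close>

lemma expectation_norm_square_mult:
  assumes Z: "circular_quartic Z" and W: "circular_quartic W"
    and lin: "\<And>u. circular_quartic (\<lambda>\<omega>. Z \<omega> + u * W \<omega>)"
  shows "integrable M (\<lambda>\<omega>. (cmod (Z \<omega>))\<^sup>2 * (cmod (W \<omega>))\<^sup>2)"
    and "expectation (\<lambda>\<omega>. (cmod (Z \<omega>))\<^sup>2 * (cmod (W \<omega>))\<^sup>2) =
      expectation (\<lambda>\<omega>. (cmod (Z \<omega>))\<^sup>2) * expectation (\<lambda>\<omega>. (cmod (W \<omega>))\<^sup>2) +
      (cmod (expectation (\<lambda>\<omega>. Z \<omega> * cnj (W \<omega>))))\<^sup>2"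
proof -
  note [measurable] = circular_quartic_measurable[OF Z] circular_quartic_measurable[OF W]
  note int = circular_quartic_integrable_norm_power[OF Z] circular_quartic_integrable_norm_power[OF W]
  have C: "integrable M (\<lambda>\<omega>. Z \<omega> * cnj (W \<omega>))"
    by (rule integrable_mult_cnj[OF Z W])
  show X: "integrable M (\<lambda>\<omega>. (cmod (Z \<omega>))\<^sup>2 * (cmod (W \<omega>))\<^sup>2)"
  proof (rule Bochner_Integration.integrable_bound)
    show "integrable M (\<lambda>\<omega>. cmod (Z \<omega>) ^ 4 + cmod (W \<omega>) ^ 4)" using int by simp
    have "a\<^sup>2 * b\<^sup>2 \<le> a ^ 4 + b ^ 4" for a b :: real
    proof -
      have "2 * (a\<^sup>2 * b\<^sup>2) \<le> a ^ 4 + b ^ 4" using sum_squares_bound[of "a\<^sup>2" "b\<^sup>2"] by simp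
      moreover have "0 \<le> a\<^sup>2 * b\<^sup>2" by simp
      ultimately show ?thesis by linarith
    qed
    then show "AE \<omega> in M. norm ((cmod (Z \<omega>))\<^sup>2 * (cmod (W \<omega>))\<^sup>2) \<le> norm (cmod (Z \<omega>) ^ 4 + cmod (W \<omega>) ^ 4)"
      by (intro AE_I2) simp
  qed simp
  define vZ where "vZ = expectation (\<lambda>\<omega>. (cmod (Z \<omega>))\<^sup>2)"
  define vW where "vW = expectation (\<lambda>\<omega>. (cmod (W \<omega>))\<^sup>2)"
  define c where "c = expectation (\<lambda>\<omega>. Z \<omega> * cnj (W \<omega>))"
  define x where "x = expectation (\<lambda>\<omega>. (cmod (Z \<omega>))\<^sup>2 * (cmod (W \<omega>))\<^sup>2)"
  have sq: "(cmod (z + u * w))\<^sup>2 = (cmod z)\<^sup>2 + (cmod u)\<^sup>2 * (cmod w)\<^sup>2 + 2 * Re (cnj u * (z * cnj w))" for z w u :: complex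
    by (simp only: cmod_power2) (simp add: power2_eq_square algebra_simps)
  have v: "expectation (\<lambda>\<omega>. (cmod (Z \<omega> + u * W \<omega>))\<^sup>2) = vZ + (cmod u)\<^sup>2 * vW + 2 * Re (cnj u * c)" for u
  proof -
    have "expectation (\<lambda>\<omega>. Re (cnj u * (Z \<omega> * cnj (W \<omega>)))) = Re (cnj u * c)"
      using C by (subst integral_Re) (auto simp: c_def simp del: times_complex.sel)
    moreover have "integrable M (\<lambda>\<omega>. Re (cnj u * (Z \<omega> * cnj (W \<omega>))))"
      using C by (intro integrable_Re) auto
    ultimately show ?thesis
      using int(1)[of 2] int(2)[of 2] unfolding sq
      by (simp add: vZ_def vW_def del: times_complex.sel)
  qed
  have m4: "expectation (\<lambda>\<omega>. cmod (Z \<omega> + u * W \<omega>) ^ 4) = 2 * (vZ + (cmod u)\<^sup>2 * vW + 2 * Re (cnj u * c))\<^sup>2" for u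
    using circular_quartic_moment4[OF lin[of u]] unfolding v .
  note int4 = circular_quartic_integrable_norm_power[OF lin, of 4, simplified]
  have avg: "cmod (z + 1 * w) ^ 4 + cmod (z + (-1) * w) ^ 4 + cmod (z + \<i> * w) ^ 4 + cmod (z + (-\<i>) * w) ^ 4
      = 4 * cmod z ^ 4 + 4 * cmod w ^ 4 + 16 * ((cmod z)\<^sup>2 * (cmod w)\<^sup>2)" for z w :: complex
  proof -
    define A B C where "A = (cmod z)\<^sup>2" and "B = (cmod w)\<^sup>2" and "C = z * cnj w"
    have e: "cmod u ^ 4 = ((cmod u)\<^sup>2)\<^sup>2" for u by simp
    have C: "A * B = (Re C)\<^sup>2 + (Im C)\<^sup>2"
      unfolding cmod_power2[of C, symmetric] by (simp add: A_def B_def C_def norm_mult power_mult_distrib)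
    have "(A + B + 2 * x)\<^sup>2 + (A + B - 2 * x)\<^sup>2 + (A + B + 2 * y)\<^sup>2 + (A + B - 2 * y)\<^sup>2 =
        4 * A\<^sup>2 + 4 * B\<^sup>2 + 8 * (A * B) + 8 * (x\<^sup>2 + y\<^sup>2)" for x y
      by (simp add: power2_eq_square algebra_simps)
    from this[of "Re C" "Im C"] show ?thesis unfolding C[symmetric]
      unfolding e sq A_def[symmetric] B_def[symmetric] C_def[symmetric] by simp
  qed
  have "expectation (\<lambda>\<omega>. cmod (Z \<omega> + 1 * W \<omega>) ^ 4 + cmod (Z \<omega> + (-1) * W \<omega>) ^ 4 +
      cmod (Z \<omega> + \<i> * W \<omega>) ^ 4 + cmod (Z \<omega> + (-\<i>) * W \<omega>) ^ 4) = 8 * vZ\<^sup>2 + 8 * vW\<^sup>2 + 16 * x"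
    unfolding avg using int(1)[of 4] int(2)[of 4] X
      circular_quartic_moment4[OF Z] circular_quartic_moment4[OF W]
    by (simp add: x_def vZ_def vW_def)
  moreover have "expectation (\<lambda>\<omega>. cmod (Z \<omega> + 1 * W \<omega>) ^ 4 + cmod (Z \<omega> + (-1) * W \<omega>) ^ 4 +
      cmod (Z \<omega> + \<i> * W \<omega>) ^ 4 + cmod (Z \<omega> + (-\<i>) * W \<omega>) ^ 4) =
    2 * (vZ + vW + 2 * Re c)\<^sup>2 + 2 * (vZ + vW - 2 * Re c)\<^sup>2 +
    2 * (vZ + vW + 2 * Im c)\<^sup>2 + 2 * (vZ + vW - 2 * Im c)\<^sup>2"
    using int4[of 1] int4[of "-1"] int4[of \<i>] int4[of "-\<i>"] m4[of 1] m4[of "-1"] m4[of \<i>] m4[of "-\<i>"] by simp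
  ultimately have "8 * vZ\<^sup>2 + 8 * vW\<^sup>2 + 16 * x = 8 * (vZ + vW)\<^sup>2 + 16 * (cmod c)\<^sup>2"
    by (simp only: cmod_power2) (simp add: power2_eq_square algebra_simps)
  then show "x = vZ * vW + (cmod c)\<^sup>2"
    by (simp add: power2_eq_square algebra_simps)
qed

lemma indep_sum_moments:
  fixes X :: "'i \<Rightarrow> 'a \<Rightarrow> real" and s q :: real
  assumes "finite I" and "indep_vars (\<lambda>_. borel) X I"
    and "\<And>i. i \<in> I \<Longrightarrow> integrable M (\<lambda>\<omega>. X i \<omega> ^ 4)"
    and "\<And>i. i \<in> I \<Longrightarrow> expectation (X i) = 0"
    and "\<And>i. i \<in> I \<Longrightarrow> expectation (\<lambda>\<omega>. (X i \<omega>)\<^sup>2) \<le> s"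
    and "\<And>i. i \<in> I \<Longrightarrow> expectation (\<lambda>\<omega>. X i \<omega> ^ 4) \<le> q"
  shows "integrable M (\<lambda>\<omega>. (\<Sum>i\<in>I. X i \<omega>) ^ 4) \<and> expectation (\<lambda>\<omega>. \<Sum>i\<in>I. X i \<omega>) = 0 \<and>
    expectation (\<lambda>\<omega>. (\<Sum>i\<in>I. X i \<omega>)\<^sup>2) \<le> card I * s \<and>
    expectation (\<lambda>\<omega>. (\<Sum>i\<in>I. X i \<omega>) ^ 4) \<le> card I * q + 3 * (card I)\<^sup>2 * s\<^sup>2"
  using assms
proof (induction I rule: finite_induct)
  case empty
  then show ?case by simp
next
  case (insert i I)
  define S where "S = (\<lambda>\<omega>. \<Sum>i\<in>I. X i \<omega>)"
  have ind: "indep_var borel (X i) borel S"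
    unfolding S_def using insert.hyps insert.prems(1) by (rule indep_vars_sum)
  have IH: "integrable M (\<lambda>\<omega>. S \<omega> ^ 4)" "expectation S = 0"
    "expectation (\<lambda>\<omega>. (S \<omega>)\<^sup>2) \<le> card I * s"
    "expectation (\<lambda>\<omega>. S \<omega> ^ 4) \<le> card I * q + 3 * (card I)\<^sup>2 * s\<^sup>2"
    using insert.IH[OF indep_vars_subset[OF insert.prems(1)]] insert.prems(2-) by (auto simp: S_def)
  have X: "integrable M (\<lambda>\<omega>. X i \<omega> ^ 4)" "expectation (X i) = 0"
    "expectation (\<lambda>\<omega>. (X i \<omega>)\<^sup>2) \<le> s" "expectation (\<lambda>\<omega>. X i \<omega> ^ 4) \<le> q"
    using insert.prems by auto
  have [measurable]: "X i \<in> borel_measurable M" "S \<in> borel_measurable M"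
    using indep_var_rv1[OF ind] indep_var_rv2[OF ind] by auto
  have pow: "integrable M (\<lambda>\<omega>. Y \<omega> ^ k)"
    if [measurable]: "Y \<in> borel_measurable M" and "integrable M (\<lambda>\<omega>. Y \<omega> ^ 4)" "k \<le> 4" for Y :: "'a \<Rightarrow> real" and k
    by (rule iffD1[OF integrable_norm_iff])
      (use that integrable_lower_power[of Y 4 k] in \<open>auto simp: power_abs power_even_abs\<close>)
  note powX = pow[OF _ X(1)] and powS = pow[OF _ IH(1)]
  have mult: "expectation (\<lambda>\<omega>. X i \<omega> ^ j * S \<omega> ^ k) =
        expectation (\<lambda>\<omega>. X i \<omega> ^ j) * expectation (\<lambda>\<omega>. S \<omega> ^ k)"
      "integrable M (\<lambda>\<omega>. X i \<omega> ^ j * S \<omega> ^ k)" if "j \<le> 4" "k \<le> 4" for j k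
    using indep_var_expectation_mult[OF ind, of "\<lambda>x. x ^ j" "\<lambda>x. x ^ k"]
      indep_var_integrable_mult[OF ind, of "\<lambda>x. x ^ j" "\<lambda>x. x ^ k"] powX[of j] powS[of k] that by auto
  have sum: "(\<Sum>i\<in>insert i I. X i \<omega>) = X i \<omega> + S \<omega>" for \<omega>
    using insert.hyps by (simp add: S_def)
  have sq: "(x + y)\<^sup>2 = x\<^sup>2 + y\<^sup>2 + 2 * (x ^ 1 * y ^ 1)"
    and quart: "(x + y) ^ 4 = x ^ 4 + y ^ 4 + 6 * (x\<^sup>2 * y\<^sup>2) + 4 * (x ^ 3 * y ^ 1) + 4 * (x ^ 1 * y ^ 3)"
    for x y :: real
    by (simp_all add: power2_eq_square power3_eq_cube power4_eq_xxxx algebra_simps)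
  have "0 \<le> expectation (\<lambda>\<omega>. (X i \<omega>)\<^sup>2)" by simp
  with X(3) have "s \<ge> 0" by linarith
  have int4: "integrable M (\<lambda>\<omega>. (X i \<omega> + S \<omega>) ^ 4)"
    unfolding quart using X IH mult(2)[of 2 2] mult(2)[of 3 1] mult(2)[of 1 3] by (intro Bochner_Integration.integrable_add integrable_mult_right) auto
  have E1: "expectation (\<lambda>\<omega>. X i \<omega> + S \<omega>) = 0"
    using powX[of 1] powS[of 1] X IH by simp
  have E2: "expectation (\<lambda>\<omega>. (X i \<omega> + S \<omega>)\<^sup>2) = expectation (\<lambda>\<omega>. (X i \<omega>)\<^sup>2) + expectation (\<lambda>\<omega>. (S \<omega>)\<^sup>2)"
    unfolding sq using powX[of 2] powS[of 2] X IH mult[of 1 1] by simp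
  have E4: "expectation (\<lambda>\<omega>. (X i \<omega> + S \<omega>) ^ 4) = expectation (\<lambda>\<omega>. X i \<omega> ^ 4) + expectation (\<lambda>\<omega>. S \<omega> ^ 4) +
      6 * (expectation (\<lambda>\<omega>. (X i \<omega>)\<^sup>2) * expectation (\<lambda>\<omega>. (S \<omega>)\<^sup>2))"
    unfolding quart using X IH mult[of 2 2] mult[of 3 1] mult[of 1 3] by simp
  have "expectation (\<lambda>\<omega>. (X i \<omega>)\<^sup>2) * expectation (\<lambda>\<omega>. (S \<omega>)\<^sup>2) \<le> s * (card I * s)"
    using X(3) IH(3) \<open>s \<ge> 0\<close> by (intro mult_mono) auto
  then have "expectation (\<lambda>\<omega>. (X i \<omega> + S \<omega>) ^ 4) \<le>
      q + (card I * q + 3 * (card I)\<^sup>2 * s\<^sup>2) + 6 * (s * (card I * s))"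
    unfolding E4 using X IH by (intro add_mono mult_left_mono) auto
  also have "\<dots> \<le> (card I + 1) * q + 3 * (real (card I) + 1)\<^sup>2 * s\<^sup>2"
    by (simp add: power2_eq_square algebra_simps)
  finally have "expectation (\<lambda>\<omega>. (X i \<omega> + S \<omega>) ^ 4) \<le> (card I + 1) * q + 3 * (real (card I) + 1)\<^sup>2 * s\<^sup>2" .
  moreover have "expectation (\<lambda>\<omega>. (X i \<omega> + S \<omega>)\<^sup>2) \<le> (card I + 1) * s"
    unfolding E2 using X(3) IH(3) by (simp add: algebra_simps)
  ultimately show ?case
    unfolding sum using int4 E1 insert.hyps by (simp add: algebra_simps)
qed

lemma indep_vars_Pair:
  assumes I: "finite I" "I \<noteq> {}"
    and X: "indep_vars S X I" and Y: "indep_vars T Y I"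
    and XY: "indep_var (PiM I S) (\<lambda>\<omega>. \<lambda>i\<in>I. X i \<omega>) (PiM I T) (\<lambda>\<omega>. \<lambda>i\<in>I. Y i \<omega>)"
  shows "indep_vars (\<lambda>i. S i \<Otimes>\<^sub>M T i) (\<lambda>i \<omega>. (X i \<omega>, Y i \<omega>)) I"
proof -
  let ?E = "\<lambda>i. {a \<times> b | a b. a \<in> sets (S i) \<and> b \<in> sets (T i)}"
  have rv [measurable]: "\<And>i. i \<in> I \<Longrightarrow> X i \<in> M \<rightarrow>\<^sub>M S i" "\<And>i. i \<in> I \<Longrightarrow> Y i \<in> M \<rightarrow>\<^sub>M T i"
    using X Y by (auto simp: indep_vars_def)
  have "prob (\<Inter>i\<in>I. (\<lambda>\<omega>. (X i \<omega>, Y i \<omega>)) -` A i \<inter> space M) =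
      (\<Prod>i\<in>I. prob ((\<lambda>\<omega>. (X i \<omega>, Y i \<omega>)) -` A i \<inter> space M))" if A: "A \<in> Pi I ?E" for A
  proof -
    have "\<forall>i\<in>I. \<exists>a b. A i = a \<times> b \<and> a \<in> sets (S i) \<and> b \<in> sets (T i)" using A by auto
    then obtain a b where ab: "\<And>i. i \<in> I \<Longrightarrow> A i = a i \<times> b i"
      and a: "\<And>i. i \<in> I \<Longrightarrow> a i \<in> sets (S i)" and b: "\<And>i. i \<in> I \<Longrightarrow> b i \<in> sets (T i)"
      by metis
    have joint: "prob ({\<omega>\<in>space M. \<forall>i\<in>J. X i \<omega> \<in> a i} \<inter> {\<omega>\<in>space M. \<forall>i\<in>J. Y i \<omega> \<in> b i}) =
        (\<Prod>i\<in>J. prob (X i -` a i \<inter> space M)) * (\<Prod>i\<in>J. prob (Y i -` b i \<inter> space M))"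
      if J: "J \<subseteq> I" "J \<noteq> {}" for J
    proof -
      define a' where "a' = (\<lambda>i. if i \<in> J then a i else space (S i))"
      define b' where "b' = (\<lambda>i. if i \<in> J then b i else space (T i))"
      have "finite J" using J I finite_subset by blast
      have a': "a' i \<in> sets (S i)" and b': "b' i \<in> sets (T i)" if "i \<in> I" for i
        using that a b by (auto simp: a'_def b'_def)
      have sp: "X i \<omega> \<in> space (S i)" "Y i \<omega> \<in> space (T i)" if "i \<in> I" "\<omega> \<in> space M" for i \<omega>
        using measurable_space[OF rv(1)] measurable_space[OF rv(2)] that by auto
      have "prob ((\<lambda>\<omega>. (\<lambda>i\<in>I. X i \<omega>, \<lambda>i\<in>I. Y i \<omega>)) -` (PiE I a' \<times> PiE I b') \<inter> space M) =
          prob ((\<lambda>\<omega>. \<lambda>i\<in>I. X i \<omega>) -` PiE I a' \<inter> space M) * prob ((\<lambda>\<omega>. \<lambda>i\<in>I. Y i \<omega>) -` PiE I b' \<inter> space M)"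
        by (rule indep_varD[OF XY]) (auto intro!: sets_PiM_I_finite I a' b')
      moreover have "(\<lambda>\<omega>. (\<lambda>i\<in>I. X i \<omega>, \<lambda>i\<in>I. Y i \<omega>)) -` (PiE I a' \<times> PiE I b') \<inter> space M =
          {\<omega>\<in>space M. \<forall>i\<in>J. X i \<omega> \<in> a i} \<inter> {\<omega>\<in>space M. \<forall>i\<in>J. Y i \<omega> \<in> b i}"
        using J sp by (auto simp: a'_def b'_def PiE_iff split: if_splits)
      moreover have "(\<lambda>\<omega>. \<lambda>i\<in>I. X i \<omega>) -` PiE I a' \<inter> space M = (\<Inter>i\<in>J. X i -` a i \<inter> space M)"
        using J sp by (auto simp: a'_def PiE_iff split: if_splits)
      moreover have "(\<lambda>\<omega>. \<lambda>i\<in>I. Y i \<omega>) -` PiE I b' \<inter> space M = (\<Inter>i\<in>J. Y i -` b i \<inter> space M)"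
        using J sp by (auto simp: b'_def PiE_iff split: if_splits)
      moreover have "prob (\<Inter>i\<in>J. X i -` a i \<inter> space M) = (\<Prod>i\<in>J. prob (X i -` a i \<inter> space M))"
        by (rule indep_varsD[OF X]) (use J \<open>finite J\<close> a in auto)
      moreover have "prob (\<Inter>i\<in>J. Y i -` b i \<inter> space M) = (\<Prod>i\<in>J. prob (Y i -` b i \<inter> space M))"
        by (rule indep_varsD[OF Y]) (use J \<open>finite J\<close> b in auto)
      ultimately show ?thesis by simp
    qed
    have "prob ((\<lambda>\<omega>. (X i \<omega>, Y i \<omega>)) -` A i \<inter> space M) =
        prob (X i -` a i \<inter> space M) * prob (Y i -` b i \<inter> space M)" if "i \<in> I" for i
      using joint[of "{i}"] that ab[OF that] by (simp add: vimage_def Int_def conj_ac)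
    moreover have "(\<Inter>i\<in>I. (\<lambda>\<omega>. (X i \<omega>, Y i \<omega>)) -` A i \<inter> space M) =
        {\<omega>\<in>space M. \<forall>i\<in>I. X i \<omega> \<in> a i} \<inter> {\<omega>\<in>space M. \<forall>i\<in>I. Y i \<omega> \<in> b i}"
      using I ab by auto
    ultimately show ?thesis using joint[of I] I by (simp add: prod.distrib)
  qed
  then show ?thesis
    using I by (subst indep_vars_finite[where E = ?E])
      (auto simp: sets_pair_measure space_pair_measure Int_stable_pair_measure_generator
        dest: sets.sets_into_space)
qed

end

section \<open>The observation model\<close>

lemma sum_power4_le:
  fixes f :: "'i \<Rightarrow> real"
  shows "(\<Sum>i\<in>I. f i) ^ 4 \<le> card I ^ 3 * (\<Sum>i\<in>I. f i ^ 4)"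
proof -
  have "(\<Sum>i\<in>I. f i) ^ 4 = ((\<Sum>i\<in>I. f i)\<^sup>2)\<^sup>2" by simp
  also have "\<dots> \<le> ((\<Sum>i\<in>I. (f i)\<^sup>2) * card I)\<^sup>2"
    by (intro power_mono sum_squared_le_sum_of_squares) auto
  also have "\<dots> = (\<Sum>i\<in>I. (f i)\<^sup>2)\<^sup>2 * (card I)\<^sup>2" by (simp add: power_mult_distrib)
  also have "\<dots> \<le> ((\<Sum>i\<in>I. ((f i)\<^sup>2)\<^sup>2) * card I) * (card I)\<^sup>2"
    by (intro mult_right_mono sum_squared_le_sum_of_squares) auto
  finally show ?thesis by (simp add: power2_eq_square[of "real _"] power3_eq_cube mult_ac)
qed

lemma sum_squares_le_square_sum:
  fixes f :: "'i \<Rightarrow> real"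
  assumes "finite I" "\<And>i. i \<in> I \<Longrightarrow> 0 \<le> f i"
  shows "(\<Sum>i\<in>I. (f i)\<^sup>2) \<le> (\<Sum>i\<in>I. f i)\<^sup>2"
proof -
  have "(\<Sum>i\<in>I. (f i)\<^sup>2) \<le> (\<Sum>i\<in>I. f i * (\<Sum>j\<in>I. f j))"
    unfolding power2_eq_square using assms
    by (intro sum_mono mult_left_mono member_le_sum) auto
  then show ?thesis by (simp add: power2_eq_square sum_distrib_right)
qed

lemma polarization_sum:
  "4 * (z * cnj v) = (\<Sum>u\<in>{1, -1, \<i>, -\<i>}. u * complex_of_real ((cmod (z + u * v))\<^sup>2))"
proof -
  have "\<i> \<noteq> -1" "\<i> \<noteq> -\<i>" "1 \<noteq> -\<i>" "\<i> \<noteq> 1" "1 \<noteq> - (1::complex)" "-\<i> \<noteq> 1" "-1 \<noteq> -\<i>" "-1 \<noteq> \<i>" "1 \<noteq> \<i>"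
    by (auto simp: complex_eq_iff)
  then show ?thesis
    unfolding cmod_power2 by (simp add: complex_eq_iff power2_eq_square algebra_simps)
qed

context ar_observation_model
begin

abbreviation r :: "int \<Rightarrow> complex" where "r \<equiv> autocov M vx (h 0)"

abbreviation y :: "nat \<Rightarrow> int \<Rightarrow> 'a \<Rightarrow> complex" where "y n t \<omega> \<equiv> h n t \<omega> + w n t \<omega>"

lemma h_measurable [measurable]: "h n t \<in> borel_measurable M"
  using h_gaussian by (simp add: circ_gaussian_process_def)

lemma w_measurable [measurable]: "t \<ge> 0 \<Longrightarrow> w n t \<in> borel_measurable M"
  using w_indep unfolding indep_vars_def by force

lemma h_path_measurable [measurable]: "(\<lambda>\<omega> t. h n (t + s) \<omega>) \<in> M \<rightarrow>\<^sub>M (\<Pi>\<^sub>M t\<in>UNIV. borel)"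
  by (rule measurable_PiM_single') auto

lemma
  fixes f :: "(int \<Rightarrow> complex) \<Rightarrow> 'b::{banach, second_countable_topology}"
  assumes [measurable]: "f \<in> borel_measurable (\<Pi>\<^sub>M t\<in>UNIV. borel)"
  shows expectation_h_shift: "expectation (\<lambda>\<omega>. f (\<lambda>t. h n (t + s) \<omega>)) = expectation (\<lambda>\<omega>. f (\<lambda>t. h 0 t \<omega>))"
proof -
  have "process_law M (\<lambda>t. h n (t + s)) = process_law M (h 0)"
    using h_stationary[of n] h_ident[of n 0] by (simp add: stationary_process_def)
  moreover have law: "expectation (\<lambda>\<omega>. f (\<lambda>t. h n (t + s) \<omega>)) = integral\<^sup>L (process_law M (\<lambda>t. h n (t + s))) f" for n s
    unfolding process_law_def by (subst integral_distr) auto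
  ultimately show ?thesis using law[of 0 0] by simp
qed

lemma h_sum_quartic:
  assumes "finite S"
  shows "circular_quartic (\<lambda>\<omega>. \<Sum>t\<in>S. b t * h n t \<omega>)"
proof -
  obtain v where "v \<ge> 0" "distr M borel (\<lambda>\<omega>. \<Sum>t\<in>S. b t * h n t \<omega>) = circ_normal v"
    using h_gaussian[of n] assms unfolding circ_gaussian_process_def by blast
  then show ?thesis by (intro circular_quartic_circ_normal) auto
qed

lemma h_quartic: "circular_quartic (h n t)"
  using h_sum_quartic[of "{t}" "\<lambda>_. 1" n] by simp

lemma w_quartic: "t \<ge> 0 \<Longrightarrow> circular_quartic (w n t)"
  and w_variance: "t \<ge> 0 \<Longrightarrow> expectation (\<lambda>\<omega>. (cmod (w n t \<omega>))\<^sup>2) = vw"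
  using circular_quartic_circ_normal[OF w_measurable w_law vw_nonneg] by auto

lemma h_covariance: "expectation (\<lambda>\<omega>. h n s \<omega> * cnj (h n t \<omega>)) = vx * r (s - t)"
  using expectation_h_shift[of "\<lambda>g. g 0 * cnj (g (t - s))" n s] vx_pos by (simp add: autocov_def)

lemma yule_walker_equations:
  assumes k: "k \<in> {1..p}"
  shows "r (int k) = (\<Sum>j=1..p. complex_of_real (a j) * r (int k - int j))"
proof -
  have x_meas [measurable]: "x 0 0 \<in> borel_measurable M"
    using x_indep unfolding indep_vars_def by force
  have x0: "circular_quartic (x 0 0)"
    using vx_pos by (intro circular_quartic_circ_normal(1)[OF x_meas x_law]) simp
  have x_h: "expectation (\<lambda>\<omega>. x 0 0 \<omega> * cnj (h 0 (- int k) \<omega>)) = 0"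
    using indep_var_expectation_mult[OF x_indep_past[of 0 0], of "\<lambda>g. g 0" "\<lambda>g. cnj (g (- int k))"]
      k x0 h_quartic[of 0 "- int k"]
    by (simp add: circular_quartic_mean circular_quartic_integrable)
  have "vx * r (int k) = expectation (\<lambda>\<omega>. h 0 0 \<omega> * cnj (h 0 (- int k) \<omega>))"
    by (simp add: h_covariance)
  also have "\<dots> = expectation (\<lambda>\<omega>. ((\<Sum>j=1..p. a j * h 0 (0 - int j) \<omega>) + x 0 0 \<omega>) * cnj (h 0 (- int k) \<omega>))"
    using ar_equation[of 0 0] by (intro integral_cong_AE) (auto elim: eventually_mono)
  also have "\<dots> = expectation (\<lambda>\<omega>. (\<Sum>j=1..p. a j * (h 0 (- int j) \<omega> * cnj (h 0 (- int k) \<omega>))) +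
      x 0 0 \<omega> * cnj (h 0 (- int k) \<omega>))"
    by (simp add: distrib_right sum_distrib_right mult.assoc)
  also have "\<dots> = (\<Sum>j=1..p. a j * (vx * r (int k - int j)))"
    using integrable_mult_cnj[OF h_quartic h_quartic] integrable_mult_cnj[OF x0 h_quartic]
    by (simp add: x_h h_covariance)
  also have "\<dots> = vx * (\<Sum>j=1..p. a j * r (int k - int j))"
    by (simp add: sum_distrib_left mult_ac)
  finally show ?thesis using vx_pos by simp
qed

lemma w_indep_mult:
  assumes "s \<ge> 0" "finite A" "A \<subseteq> {0..}" "s \<notin> A"
  shows "indep_var borel (\<lambda>\<omega>. b s * w n s \<omega>) borel (\<lambda>\<omega>. \<Sum>t\<in>A. b t * w n t \<omega>)"
proof -
  have "indep_var borel ((\<lambda>g. b s * g (n, s)) \<circ> (\<lambda>\<omega>. \<lambda>i\<in>{(n, s)}. (case i of (n, t) \<Rightarrow> w n t) \<omega>))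
      borel ((\<lambda>g. \<Sum>t\<in>A. b t * g (n, t)) \<circ> (\<lambda>\<omega>. \<lambda>i\<in>{n} \<times> A. (case i of (n, t) \<Rightarrow> w n t) \<omega>))"
    using assms by (intro indep_var_compose[OF indep_var_restrict[OF w_indep]]) auto
  then show ?thesis by (simp add: comp_def cong: sum.cong)
qed

lemma w_sum_quartic:
  assumes "finite A" "A \<subseteq> {0..}"
  shows "circular_quartic (\<lambda>\<omega>. \<Sum>t\<in>A. b t * w n t \<omega>)"
  using assms
proof (induction A rule: finite_induct)
  case empty
  then show ?case by (simp add: circular_quartic_zero)
next
  case (insert s A)
  then show ?case
    using circular_quartic_add[OF circular_quartic_mult[OF w_quartic] insert.IH w_indep_mult]
    by (simp add: insert.hyps)
qed

lemma indep_h_w: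
  assumes [measurable]: "f \<in> borel_measurable (\<Pi>\<^sub>M nt\<in>UNIV \<times> {0..}. borel)"
    "g \<in> borel_measurable (\<Pi>\<^sub>M nt\<in>UNIV. borel)"
  shows "indep_var borel (\<lambda>\<omega>. f (\<lambda>(n, t)\<in>UNIV \<times> {0..}. w n t \<omega>)) borel (\<lambda>\<omega>. g (\<lambda>(n, t). h n t \<omega>))"
  using indep_var_compose[OF w_indep_h, of f borel g borel] by (simp add: comp_def)

lemma indep_w_sum_h_sum:
  assumes "finite A" "A \<subseteq> {0..}" "finite B"
  shows "indep_var borel (\<lambda>\<omega>. \<Sum>t\<in>A. b t * w n t \<omega>) borel (\<lambda>\<omega>. \<Sum>t\<in>B. c t * h n t \<omega>)"
proof -
  have "indep_var borel (\<lambda>\<omega>. \<Sum>t\<in>A. b t * (\<lambda>(n, t)\<in>UNIV \<times> {0..}. w n t \<omega>) (n, t))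
      borel (\<lambda>\<omega>. \<Sum>t\<in>B. c t * (case (n, t) of (n, t) \<Rightarrow> h n t \<omega>))"
    using assms
    by (intro indep_h_w[of "\<lambda>f. \<Sum>t\<in>A. b t * f (n, t)" "\<lambda>f. \<Sum>t\<in>B. c t * f (n, t)"]
        borel_measurable_sum borel_measurable_times measurable_component_singleton) auto
  also have "(\<lambda>\<omega>. \<Sum>t\<in>A. b t * (\<lambda>(n, t)\<in>UNIV \<times> {0..}. w n t \<omega>) (n, t)) = (\<lambda>\<omega>. \<Sum>t\<in>A. b t * w n t \<omega>)"
    using assms(2) by (intro ext sum.cong) auto
  finally show ?thesis by simp
qed

lemma y_sum_quartic:
  assumes "finite A" "A \<subseteq> {0..}"
  shows "circular_quartic (\<lambda>\<omega>. \<Sum>t\<in>A. b t * y n t \<omega>)"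
  using circular_quartic_add[OF w_sum_quartic h_sum_quartic indep_w_sum_h_sum, of A A b n b] assms
  by (simp add: distrib_left sum.distrib add.commute)

lemma y_quartic: "t \<ge> 0 \<Longrightarrow> circular_quartic (y n t)"
  using y_sum_quartic[of "{t}" "\<lambda>_. 1" n] by simp

definition \<gamma> :: "int \<Rightarrow> complex" where
  "\<gamma> k = vx * r k + (if k = 0 then vw else 0)"

lemma y_covariance:
  assumes "s \<ge> 0" "t \<ge> 0"
  shows "expectation (\<lambda>\<omega>. y n s \<omega> * cnj (y n t \<omega>)) = \<gamma> (s - t)"
proof -
  have hw: "expectation (\<lambda>\<omega>. h n s \<omega> * cnj (w n t \<omega>)) = 0"
      "expectation (\<lambda>\<omega>. w n s \<omega> * cnj (h n t \<omega>)) = 0"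
  proof -
    have ind: "indep_var borel (w n t') borel (h n s')" if "t' \<ge> 0" for s' t'
      using indep_w_sum_h_sum[of "{t'}" "{s'}" "\<lambda>_. 1" n "\<lambda>_. 1"] that by simp
    show "expectation (\<lambda>\<omega>. w n s \<omega> * cnj (h n t \<omega>)) = 0"
      by (intro indep_var_covariance_eq_0 ind w_quartic h_quartic assms)
    show "expectation (\<lambda>\<omega>. h n s \<omega> * cnj (w n t \<omega>)) = 0"
      by (intro indep_var_covariance_eq_0 ind w_quartic h_quartic assms)
  qed
  have ww: "expectation (\<lambda>\<omega>. w n s \<omega> * cnj (w n t \<omega>)) = (if s = t then vw else 0)"
  proof (cases "s = t")
    case True
    then have "expectation (\<lambda>\<omega>. w n s \<omega> * cnj (w n t \<omega>)) =
        expectation (\<lambda>\<omega>. complex_of_real ((cmod (w n s \<omega>))\<^sup>2))"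
      by (simp only: complex_norm_square)
    then show ?thesis
      using True by (simp only: integral_complex_of_real w_variance[OF assms(2)]) simp
  next
    case False
    then have "indep_var borel (w n s) borel (w n t)"
      using w_indep_mult[of s "{t}" "\<lambda>_. 1" n] assms by simp
    then have "expectation (\<lambda>\<omega>. w n s \<omega> * cnj (w n t \<omega>)) = 0"
      by (intro indep_var_covariance_eq_0 w_quartic assms)
    with False show ?thesis by simp
  qed
  note int = integrable_mult_cnj[OF h_quartic h_quartic] integrable_mult_cnj[OF h_quartic w_quartic]
    integrable_mult_cnj[OF w_quartic h_quartic] integrable_mult_cnj[OF w_quartic w_quartic]
  have "expectation (\<lambda>\<omega>. y n s \<omega> * cnj (y n t \<omega>)) =
      expectation (\<lambda>\<omega>. h n s \<omega> * cnj (h n t \<omega>) + h n s \<omega> * cnj (w n t \<omega>) +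
        (w n s \<omega> * cnj (h n t \<omega>) + w n s \<omega> * cnj (w n t \<omega>)))"
    by (simp add: algebra_simps)
  also have "\<dots> = \<gamma> (s - t)"
    using assms int by (simp add: hw ww h_covariance \<gamma>_def)
  finally show ?thesis .
qed

lemma y_moment8:
  obtains C where "C \<ge> 0" "\<And>n t. t \<ge> 0 \<Longrightarrow> expectation (\<lambda>\<omega>. cmod (y n t \<omega>) ^ 8) \<le> C"
proof
  define Ch where "Ch = expectation (\<lambda>\<omega>. cmod (h 0 0 \<omega>) ^ 8)"
  define Cw where "Cw = (LINT z|circ_normal vw. cmod z ^ 8)"
  have "Ch \<ge> 0" "Cw \<ge> 0" by (simp_all add: Ch_def Cw_def)
  then show "0 \<le> 2 ^ 8 * (Ch + Cw)" by simp
  fix n and t :: int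
  assume t: "t \<ge> 0"
  have h: "expectation (\<lambda>\<omega>. cmod (h n t \<omega>) ^ 8) = Ch"
    using expectation_h_shift[of "\<lambda>g. cmod (g 0) ^ 8" n t] by (simp add: Ch_def)
  have w: "expectation (\<lambda>\<omega>. cmod (w n t \<omega>) ^ 8) = Cw"
    unfolding Cw_def w_law[OF t, of n, symmetric] using t by (subst integral_distr) auto
  have "expectation (\<lambda>\<omega>. cmod (y n t \<omega>) ^ 8) \<le> expectation (\<lambda>\<omega>. 2 ^ 8 * (cmod (h n t \<omega>) ^ 8 + cmod (w n t \<omega>) ^ 8))"
  proof (rule integral_mono)
    show "cmod (y n t \<omega>) ^ 8 \<le> 2 ^ 8 * (cmod (h n t \<omega>) ^ 8 + cmod (w n t \<omega>) ^ 8)" for \<omega>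
      by (rule order_trans[OF power_mono[OF norm_triangle_ineq] power_add_le]) auto
  qed (use circular_quartic_integrable_norm_power[OF y_quartic[OF t]]
      circular_quartic_integrable_norm_power[OF h_quartic]
      circular_quartic_integrable_norm_power[OF w_quartic[OF t]] in auto)
  also have "\<dots> = 2 ^ 8 * (Ch + Cw)"
    using circular_quartic_integrable_norm_power[OF h_quartic, of 8 n t]
      circular_quartic_integrable_norm_power[OF w_quartic[OF t], of 8 n] by (simp add: h w)
  finally show "expectation (\<lambda>\<omega>. cmod (y n t \<omega>) ^ 8) \<le> 2 ^ 8 * (Ch + Cw)" .
qed

lemma indep_vars_w_h_paths:
  assumes "N \<ge> 1"
  shows "indep_vars (\<lambda>_. (\<Pi>\<^sub>M t\<in>{0..}. borel) \<Otimes>\<^sub>M (\<Pi>\<^sub>M t\<in>UNIV. borel))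
    (\<lambda>n \<omega>. (\<lambda>t\<in>{0..}. w n t \<omega>, \<lambda>t. h n t \<omega>)) {..<N}"
proof (rule indep_vars_Pair)
  show "finite {..<N}" "{..<N} \<noteq> {}" using assms by (auto simp: lessThan_empty_iff)
  show "indep_vars (\<lambda>_. \<Pi>\<^sub>M t\<in>UNIV. borel) (\<lambda>n \<omega> t. h n t \<omega>) {..<N}"
    using h_indep by (rule indep_vars_subset) auto
  have "indep_vars (\<lambda>n. \<Pi>\<^sub>M i\<in>{n} \<times> {0..}. borel)
      (\<lambda>n \<omega>. \<lambda>i\<in>{n} \<times> {0..}. (case i of (n, t) \<Rightarrow> w n t) \<omega>) {..<N}"
    by (rule indep_vars_restrict[OF w_indep]) (auto simp: disjoint_family_on_def)
  then have "indep_vars (\<lambda>_. \<Pi>\<^sub>M t\<in>{0..}. borel)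
      (\<lambda>n \<omega>. (\<lambda>g. \<lambda>t\<in>{0..}. g (n, t)) (\<lambda>i\<in>{n} \<times> {0..}. (case i of (n, t) \<Rightarrow> w n t) \<omega>)) {..<N}"
    by (rule indep_vars_compose2) (intro measurable_restrict measurable_component_singleton; simp)
  then show "indep_vars (\<lambda>_. \<Pi>\<^sub>M t\<in>{0..}. borel) (\<lambda>n \<omega>. \<lambda>t\<in>{0..}. w n t \<omega>) {..<N}"
    by (simp cong: restrict_cong)
  have "indep_var (\<Pi>\<^sub>M n\<in>{..<N}. \<Pi>\<^sub>M t\<in>{0..}. borel)
      ((\<lambda>g. \<lambda>n\<in>{..<N}. \<lambda>t\<in>{0..}. g (n, t)) \<circ> (\<lambda>\<omega>. \<lambda>(n, t)\<in>UNIV \<times> {0..}. w n t \<omega>))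
      (\<Pi>\<^sub>M n\<in>{..<N}. \<Pi>\<^sub>M t\<in>UNIV. borel)
      ((\<lambda>g. \<lambda>n\<in>{..<N}. \<lambda>t\<in>UNIV. g (n, t)) \<circ> (\<lambda>\<omega> (n, t). h n t \<omega>))"
    by (intro indep_var_compose[OF w_indep_h] measurable_restrict measurable_component_singleton) auto
  then show "indep_var (\<Pi>\<^sub>M n\<in>{..<N}. \<Pi>\<^sub>M t\<in>{0..}. borel) (\<lambda>\<omega>. \<lambda>n\<in>{..<N}. \<lambda>t\<in>{0..}. w n t \<omega>)
      (\<Pi>\<^sub>M n\<in>{..<N}. \<Pi>\<^sub>M t\<in>UNIV. borel) (\<lambda>\<omega>. \<lambda>n\<in>{..<N}. \<lambda>t. h n t \<omega>)"
    by (simp add: comp_def restrict_def cong: if_cong)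
qed

text \<open>By polarization, the products \<open>y n (t + k) * cnj (y n t)\<close> are combinations of squared moduli of
  \<open>lag_comb k u n t\<close> with \<open>u\<close> a fourth root of unity. This replaces them by real variables.\<close>

definition lag_comb :: "int \<Rightarrow> complex \<Rightarrow> nat \<Rightarrow> int \<Rightarrow> 'a \<Rightarrow> complex" where
  "lag_comb k u n t \<omega> = y n (t + k) \<omega> + u * y n t \<omega>"

lemma lag_comb_quartic_add:
  assumes "t \<ge> 0" "t + k \<ge> 0" "s \<ge> 0" "s + k \<ge> 0"
  shows "circular_quartic (\<lambda>\<omega>. lag_comb k u n t \<omega> + v * lag_comb k u n s \<omega>)"
proof -
  define A where "A = {t + k, t, s + k, s}"
  define b where "b = (\<lambda>\<tau>. (if \<tau> = t + k then 1 else 0) + (if \<tau> = t then u else 0) +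
    (if \<tau> = s + k then v else 0) + (if \<tau> = s then v * u else 0))"
  have delta: "(\<Sum>\<tau>\<in>A. (if \<tau> = c then d else 0) * f \<tau>) = d * f c" if "c \<in> A"
    for c and d :: complex and f
    using that by (subst sum.remove[of A c]) (auto simp: A_def intro!: sum.neutral)
  have "circular_quartic (\<lambda>\<omega>. \<Sum>\<tau>\<in>A. b \<tau> * y n \<tau> \<omega>)"
    using assms by (intro y_sum_quartic) (auto simp: A_def)
  also have "(\<lambda>\<omega>. \<Sum>\<tau>\<in>A. b \<tau> * y n \<tau> \<omega>) = (\<lambda>\<omega>. lag_comb k u n t \<omega> + v * lag_comb k u n s \<omega>)"
    unfolding b_def distrib_right[of "_ + _"] distrib_right[of "if _ then _ else _"] sum.distrib
    by (subst delta, simp add: A_def)+ (simp add: lag_comb_def algebra_simps)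
  finally show ?thesis .
qed

lemma lag_comb_quartic: "t \<ge> 0 \<Longrightarrow> t + k \<ge> 0 \<Longrightarrow> circular_quartic (lag_comb k u n t)"
  using lag_comb_quartic_add[of t k t u n 0] by simp

lemma lag_comb_covariance:
  assumes "t \<ge> 0" "t + k \<ge> 0" "s \<ge> 0" "s + k \<ge> 0" "cmod u = 1"
  shows "expectation (\<lambda>\<omega>. lag_comb k u n t \<omega> * cnj (lag_comb k u n s \<omega>)) =
    2 * \<gamma> (t - s) + cnj u * \<gamma> (t + k - s) + u * \<gamma> (t - k - s)"
proof -
  have u: "u * cnj u = 1" using assms(5) by (simp flip: complex_norm_square)
  note int = integrable_mult_cnj[OF y_quartic y_quartic]
  have expand: "(z1 + u * z2) * cnj (z3 + u * z4) = z1 * cnj z3 + cnj u * (z1 * cnj z4) +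
      (u * (z2 * cnj z3) + (u * cnj u) * (z2 * cnj z4))" for z1 z2 z3 z4
    by (simp add: algebra_simps)
  have "lag_comb k u n t \<omega> * cnj (lag_comb k u n s \<omega>) =
      y n (t + k) \<omega> * cnj (y n (s + k) \<omega>) + cnj u * (y n (t + k) \<omega> * cnj (y n s \<omega>)) +
      (u * (y n t \<omega> * cnj (y n (s + k) \<omega>)) + (u * cnj u) * (y n t \<omega> * cnj (y n s \<omega>)))" for \<omega>
    unfolding lag_comb_def by (rule expand)
  then have "expectation (\<lambda>\<omega>. lag_comb k u n t \<omega> * cnj (lag_comb k u n s \<omega>)) =
      expectation (\<lambda>\<omega>. y n (t + k) \<omega> * cnj (y n (s + k) \<omega>) + cnj u * (y n (t + k) \<omega> * cnj (y n s \<omega>)) +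
      (u * (y n t \<omega> * cnj (y n (s + k) \<omega>)) + (u * cnj u) * (y n t \<omega> * cnj (y n s \<omega>))))"
    by simp
  also have "\<dots> = \<gamma> (t + k - (s + k)) + cnj u * \<gamma> (t + k - s) + (u * \<gamma> (t - (s + k)) + (u * cnj u) * \<gamma> (t - s))"
    using assms int[of "t + k" "s + k"] int[of "t + k" s] int[of t "s + k"] int[of t s]
      y_covariance[of "t + k" "s + k"] y_covariance[of "t + k" s] y_covariance[of t "s + k"]
      y_covariance[of t s]
    by (simp del: complex_cnj_add)
  finally show ?thesis by (simp add: u algebra_simps)
qed

lemma sum_\<gamma>_le:
  assumes K: "\<And>T. (\<Sum>k=1 - int T..int T - 1. cmod (r k)) \<le> K" and "finite D"
  shows "(\<Sum>d\<in>D. cmod (\<gamma> d)) \<le> vx * K + vw"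
proof -
  define T where "T = Suc (nat (\<Sum>d\<in>D. \<bar>d\<bar>))"
  have "\<bar>d\<bar> \<le> int T - 1" if "d \<in> D" for d
    using member_le_sum[of d D abs] that \<open>finite D\<close> by (simp add: T_def)
  then have D: "D \<subseteq> {1 - int T..int T - 1}" by force
  have "(\<Sum>d\<in>D. cmod (\<gamma> d)) \<le> (\<Sum>d\<in>D. vx * cmod (r d) + (if d = 0 then vw else 0))"
    using vx_pos vw_nonneg
    by (intro sum_mono order_trans[OF norm_triangle_ineq, of _ "(if _ = 0 then vw else 0)"] order.refl)
      (auto simp: \<gamma>_def norm_mult intro: order_trans[OF norm_triangle_ineq])
  also have "\<dots> = vx * (\<Sum>d\<in>D. cmod (r d)) + (if 0 \<in> D then vw else 0)"
    using \<open>finite D\<close> by (simp add: sum.distrib sum_distrib_left)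
  also have "(\<Sum>d\<in>D. cmod (r d)) \<le> K"
    using sum_mono2[OF _ D, of "\<lambda>d. cmod (r d)"] K[of T] by simp
  finally show ?thesis using vx_pos vw_nonneg by (simp add: mult_left_mono split: if_splits)
qed

definition energy_dev :: "int set \<Rightarrow> int \<Rightarrow> complex \<Rightarrow> nat \<Rightarrow> 'a \<Rightarrow> real" where
  "energy_dev S k u n \<omega> = (\<Sum>t\<in>S. (cmod (lag_comb k u n t \<omega>))\<^sup>2 - expectation (\<lambda>\<omega>. (cmod (lag_comb k u n t \<omega>))\<^sup>2))"

lemma energy_dev_mean_variance:
  assumes K: "\<And>T. (\<Sum>k=1 - int T..int T - 1. cmod (r k)) \<le> K"
    and S: "finite S" "S \<subseteq> {t. 0 \<le> t \<and> 0 \<le> t + k}" and u: "cmod u = 1"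
  shows "expectation (energy_dev S k u n) = 0"
    and "expectation (\<lambda>\<omega>. (energy_dev S k u n \<omega>)\<^sup>2) \<le> 16 * (vx * K + vw)\<^sup>2 * card S"
proof -
  define B where "B = (\<lambda>t \<omega>. (cmod (lag_comb k u n t \<omega>))\<^sup>2)"
  define m where "m = (\<lambda>t. expectation (B t))"
  define c where "c = (\<lambda>t s. expectation (\<lambda>\<omega>. lag_comb k u n t \<omega> * cnj (lag_comb k u n s \<omega>)))"
  have energy_dev: "energy_dev S k u n \<omega> = (\<Sum>t\<in>S. B t \<omega> - m t)" for \<omega>
    by (simp add: energy_dev_def B_def m_def)
  have ge: "0 \<le> t" "0 \<le> t + k" if "t \<in> S" for t using S that by auto
  have int: "integrable M (B t)" if "t \<in> S" for t
    unfolding B_def using circular_quartic_integrable_norm_power[OF lag_comb_quartic] ge[OF that] by auto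
  have prod: "integrable M (\<lambda>\<omega>. B t \<omega> * B s \<omega>)"
      "expectation (\<lambda>\<omega>. B t \<omega> * B s \<omega>) = m t * m s + (cmod (c t s))\<^sup>2" if "t \<in> S" "s \<in> S" for t s
    using expectation_norm_square_mult[OF lag_comb_quartic lag_comb_quartic lag_comb_quartic_add] ge that
    by (auto simp: B_def m_def c_def)
  show "expectation (energy_dev S k u n) = 0"
    unfolding energy_dev[abs_def] using int by (simp add: m_def prob_space)
  have cross: "expectation (\<lambda>\<omega>. (B t \<omega> - m t) * (B s \<omega> - m s)) = (cmod (c t s))\<^sup>2"
      "integrable M (\<lambda>\<omega>. (B t \<omega> - m t) * (B s \<omega> - m s))" if "t \<in> S" "s \<in> S" for t s
  proof -
    have e: "(B t \<omega> - m t) * (B s \<omega> - m s) = B t \<omega> * B s \<omega> - m s * B t \<omega> - m t * B s \<omega> + m t * m s" for \<omega>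
      by (simp add: algebra_simps)
    show "expectation (\<lambda>\<omega>. (B t \<omega> - m t) * (B s \<omega> - m s)) = (cmod (c t s))\<^sup>2"
      "integrable M (\<lambda>\<omega>. (B t \<omega> - m t) * (B s \<omega> - m s))"
      unfolding e using int prod that by (simp_all add: prob_space m_def)
  qed
  have "expectation (\<lambda>\<omega>. (energy_dev S k u n \<omega>)\<^sup>2) =
      expectation (\<lambda>\<omega>. \<Sum>t\<in>S. \<Sum>s\<in>S. (B t \<omega> - m t) * (B s \<omega> - m s))"
    by (simp add: energy_dev power2_eq_square sum_product)
  also have "\<dots> = (\<Sum>t\<in>S. \<Sum>s\<in>S. (cmod (c t s))\<^sup>2)"
    using cross by simp
  also have "\<dots> \<le> (\<Sum>t\<in>S. (4 * (vx * K + vw))\<^sup>2)"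
  proof (rule sum_mono)
    fix t assume t: "t \<in> S"
    let ?G = "vx * K + vw"
    have shift: "(\<Sum>s\<in>S. cmod (\<gamma> (d - s))) \<le> ?G" for d
    proof -
      have "(\<Sum>s\<in>S. cmod (\<gamma> (d - s))) = (\<Sum>e\<in>(\<lambda>s. d - s) ` S. cmod (\<gamma> e))"
        by (subst sum.reindex) (auto simp: inj_on_def)
      then show ?thesis using sum_\<gamma>_le[OF K, of "(\<lambda>s. d - s) ` S"] S by simp
    qed
    have "cmod (c t s) \<le> 2 * cmod (\<gamma> (t - s)) + cmod (\<gamma> (t + k - s)) + cmod (\<gamma> (t - k - s))"
      if "s \<in> S" for s
      unfolding c_def using lag_comb_covariance[of t k s u n] ge t that u
      by (auto simp: norm_mult intro!: order_trans[OF norm_triangle_ineq] add_mono)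
    then have "(\<Sum>s\<in>S. cmod (c t s)) \<le>
        (\<Sum>s\<in>S. 2 * cmod (\<gamma> (t - s)) + cmod (\<gamma> (t + k - s)) + cmod (\<gamma> (t - k - s)))"
      by (rule sum_mono)
    also have "\<dots> \<le> 4 * ?G"
      using shift[of t] shift[of "t + k"] shift[of "t - k"]
      by (simp add: sum.distrib flip: sum_distrib_left)
    finally have "(\<Sum>s\<in>S. cmod (c t s))\<^sup>2 \<le> (4 * ?G)\<^sup>2"
      by (intro power_mono sum_nonneg) auto
    then show "(\<Sum>s\<in>S. (cmod (c t s))\<^sup>2) \<le> (4 * ?G)\<^sup>2"
      using sum_squares_le_square_sum[of S "\<lambda>s. cmod (c t s)"] S by simp
  qed
  finally show "expectation (\<lambda>\<omega>. (energy_dev S k u n \<omega>)\<^sup>2) \<le> 16 * (vx * K + vw)\<^sup>2 * card S"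
    by (simp add: power_mult_distrib[of 4] mult_ac del: distrib_left_numeral)
qed

lemma energy_dev_fourth_moment:
  assumes C: "C \<ge> 0" "\<And>n t. t \<ge> 0 \<Longrightarrow> expectation (\<lambda>\<omega>. cmod (y n t \<omega>) ^ 8) \<le> C"
    and S: "finite S" "S \<subseteq> {t. 0 \<le> t \<and> 0 \<le> t + k}" and u: "cmod u = 1"
  shows "integrable M (\<lambda>\<omega>. energy_dev S k u n \<omega> ^ 4)"
    and "expectation (\<lambda>\<omega>. energy_dev S k u n \<omega> ^ 4) \<le> 16 * (2 ^ 9 * C + (1 + 2 ^ 9 * C) ^ 4) * card S ^ 4"
proof -
  define B where "B = (\<lambda>t \<omega>. (cmod (lag_comb k u n t \<omega>))\<^sup>2)"
  define m where "m = (\<lambda>t. expectation (B t))"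
  define M4 where "M4 = 16 * (2 ^ 9 * C + (1 + 2 ^ 9 * C) ^ 4)"
  have energy_dev: "energy_dev S k u n \<omega> = (\<Sum>t\<in>S. B t \<omega> - m t)" for \<omega>
    by (simp add: energy_dev_def B_def m_def)
  have ge: "0 \<le> t" "0 \<le> t + k" if "t \<in> S" for t using S that by auto
  have intZ: "integrable M (\<lambda>\<omega>. cmod (lag_comb k u n t \<omega>) ^ j)" if "t \<in> S" "j \<le> 8" for t j
    using circular_quartic_integrable_norm_power[OF lag_comb_quartic] ge[OF that(1)] that by auto
  have [measurable]: "lag_comb k u n t \<in> borel_measurable M" if "t \<in> S" for t
    using circular_quartic_measurable[OF lag_comb_quartic] ge[OF that] by auto
  have [measurable]: "B t \<in> borel_measurable M" if "t \<in> S" for t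
    unfolding B_def using that by measurable
  have [measurable]: "energy_dev S k u n \<in> borel_measurable M"
    unfolding energy_dev[abs_def] by measurable
  have Z8: "expectation (\<lambda>\<omega>. cmod (lag_comb k u n t \<omega>) ^ 8) \<le> 2 ^ 9 * C" if t: "t \<in> S" for t
  proof -
    note int = circular_quartic_integrable_norm_power[OF y_quartic, of _ 8 n]
    have "expectation (\<lambda>\<omega>. cmod (lag_comb k u n t \<omega>) ^ 8) \<le>
        expectation (\<lambda>\<omega>. 2 ^ 8 * (cmod (y n (t + k) \<omega>) ^ 8 + cmod (y n t \<omega>) ^ 8))"
    proof (rule integral_mono)
      show "cmod (lag_comb k u n t \<omega>) ^ 8 \<le> 2 ^ 8 * (cmod (y n (t + k) \<omega>) ^ 8 + cmod (y n t \<omega>) ^ 8)" for \<omega>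
        using order_trans[OF power_mono[OF norm_triangle_ineq] power_add_le,
            of "y n (t + k) \<omega>" "u * y n t \<omega>" 8] u
        by (simp add: lag_comb_def norm_mult)
    qed (use intZ[OF t] int ge[OF t] in auto)
    also have "\<dots> = 2 ^ 8 * (expectation (\<lambda>\<omega>. cmod (y n (t + k) \<omega>) ^ 8) + expectation (\<lambda>\<omega>. cmod (y n t \<omega>) ^ 8))"
      using int[of "t + k"] int[of t] ge[OF t] by simp
    also have "\<dots> \<le> 2 ^ 8 * (C + C)"
      using C(2) ge[OF t] by (intro mult_left_mono add_mono) auto
    finally show ?thesis by simp
  qed
  have m: "0 \<le> m t" "m t \<le> 1 + 2 ^ 9 * C" if t: "t \<in> S" for t
  proof -
    show "0 \<le> m t" by (simp add: m_def B_def)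
    have "m t \<le> expectation (\<lambda>\<omega>. 1 + cmod (lag_comb k u n t \<omega>) ^ 8)"
      unfolding m_def B_def using intZ[OF t]
      by (intro integral_mono) (auto simp: power_le_one_plus_power)
    also have "\<dots> \<le> 1 + 2 ^ 9 * C"
      using intZ[OF t, of 8] Z8[OF t] by (simp add: prob_space)
    finally show "m t \<le> 1 + 2 ^ 9 * C" .
  qed
  have bound: "(B t \<omega> - m t) ^ 4 \<le> 16 * (cmod (lag_comb k u n t \<omega>) ^ 8 + (1 + 2 ^ 9 * C) ^ 4)" if "t \<in> S" for t \<omega>
  proof -
    have "0 \<le> B t \<omega>" by (simp add: B_def)
    then have "\<bar>B t \<omega> - m t\<bar> ^ 4 \<le> (B t \<omega> + (1 + 2 ^ 9 * C)) ^ 4"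
      using m[OF that] by (intro power_mono) auto
    also have "\<dots> \<le> 2 ^ 4 * (B t \<omega> ^ 4 + (1 + 2 ^ 9 * C) ^ 4)"
      using \<open>0 \<le> B t \<omega>\<close> C(1) by (intro power_add_le) auto
    finally show ?thesis by (simp add: B_def power_even_abs)
  qed
  have V4: "energy_dev S k u n \<omega> ^ 4 \<le> card S ^ 3 * (\<Sum>t\<in>S. 16 * (cmod (lag_comb k u n t \<omega>) ^ 8 + (1 + 2 ^ 9 * C) ^ 4))" for \<omega>
  proof -
    have "energy_dev S k u n \<omega> ^ 4 \<le> card S ^ 3 * (\<Sum>t\<in>S. (B t \<omega> - m t) ^ 4)"
      unfolding energy_dev by (rule sum_power4_le)
    also have "\<dots> \<le> card S ^ 3 * (\<Sum>t\<in>S. 16 * (cmod (lag_comb k u n t \<omega>) ^ 8 + (1 + 2 ^ 9 * C) ^ 4))"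
      by (intro mult_left_mono sum_mono bound) auto
    finally show ?thesis .
  qed
  have int: "integrable M (\<lambda>\<omega>. card S ^ 3 * (\<Sum>t\<in>S. 16 * (cmod (lag_comb k u n t \<omega>) ^ 8 + (1 + 2 ^ 9 * C) ^ 4)))"
    using intZ by simp
  show int4: "integrable M (\<lambda>\<omega>. energy_dev S k u n \<omega> ^ 4)"
    by (rule Bochner_Integration.integrable_bound[OF int])
      (auto intro!: AE_I2 order_trans[OF V4] simp: power_even_abs)
  have "expectation (\<lambda>\<omega>. energy_dev S k u n \<omega> ^ 4) \<le>
      expectation (\<lambda>\<omega>. card S ^ 3 * (\<Sum>t\<in>S. 16 * (cmod (lag_comb k u n t \<omega>) ^ 8 + (1 + 2 ^ 9 * C) ^ 4)))"
    by (rule integral_mono[OF int4 int V4])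
  also have "\<dots> = card S ^ 3 * (\<Sum>t\<in>S. 16 * (expectation (\<lambda>\<omega>. cmod (lag_comb k u n t \<omega>) ^ 8) + (1 + 2 ^ 9 * C) ^ 4))"
    using intZ by (simp add: prob_space)
  also have "\<dots> \<le> card S ^ 3 * (\<Sum>t\<in>S. M4)"
    unfolding M4_def using Z8 by (intro mult_left_mono sum_mono add_right_mono) auto
  finally show "expectation (\<lambda>\<omega>. energy_dev S k u n \<omega> ^ 4) \<le> 16 * (2 ^ 9 * C + (1 + 2 ^ 9 * C) ^ 4) * card S ^ 4"
    by (simp add: M4_def power3_eq_cube power4_eq_xxxx mult_ac)
qed

lemma indep_vars_energy_dev:
  assumes S: "finite S" "S \<subseteq> {t. 0 \<le> t \<and> 0 \<le> t + k}" and "N \<ge> 1"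
  shows "indep_vars (\<lambda>_. borel) (energy_dev S k u) {..<N}"
proof -
  let ?P = "(\<Pi>\<^sub>M t\<in>{0::int..}. borel :: complex measure) \<Otimes>\<^sub>M (\<Pi>\<^sub>M t\<in>UNIV. borel :: complex measure)"
  let ?F = "\<lambda>n x. \<Sum>t\<in>S. (cmod (snd x (t + k) + fst x (t + k) + u * (snd x t + fst x t)))\<^sup>2 -
      expectation (\<lambda>\<omega>. (cmod (lag_comb k u n t \<omega>))\<^sup>2)"
  have [measurable]: "(\<lambda>x. fst x t) \<in> borel_measurable ?P" if "t \<ge> 0" for t
    by (rule measurable_compose[OF measurable_fst measurable_component_singleton]) (use that in auto)
  have [measurable]: "(\<lambda>x. snd x t) \<in> borel_measurable ?P" for t :: int
    by (rule measurable_compose[OF measurable_snd measurable_component_singleton]) auto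
  have "?F n \<in> borel_measurable ?P" for n
  proof (rule borel_measurable_sum)
    fix t assume "t \<in> S"
    then have [simp]: "0 \<le> t" "0 \<le> t + k" using S by auto
    show "(\<lambda>x. (cmod (snd x (t + k) + fst x (t + k) + u * (snd x t + fst x t)))\<^sup>2 -
      expectation (\<lambda>\<omega>. (cmod (lag_comb k u n t \<omega>))\<^sup>2)) \<in> borel_measurable ?P" by measurable
  qed
  then have "indep_vars (\<lambda>_. borel) (\<lambda>n \<omega>. ?F n (\<lambda>t\<in>{0..}. w n t \<omega>, \<lambda>t. h n t \<omega>)) {..<N}"
    by (rule indep_vars_compose2[OF indep_vars_w_h_paths[OF \<open>N \<ge> 1\<close>]])
  moreover have "?F n (\<lambda>t\<in>{0..}. w n t \<omega>, \<lambda>t. h n t \<omega>) = energy_dev S k u n \<omega>" for n \<omega>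
    unfolding energy_dev_def using S by (intro sum.cong) (auto simp: lag_comb_def)
  ultimately show ?thesis by simp
qed

definition lag_error :: "int set \<Rightarrow> nat \<Rightarrow> int \<Rightarrow> 'a \<Rightarrow> complex" where
  "lag_error S N k \<omega> = (\<Sum>n<N. \<Sum>t\<in>S. y n (t + k) \<omega> * cnj (y n t \<omega>) - \<gamma> k)"

lemma lag_error_measurable:
  assumes "S \<subseteq> {t. 0 \<le> t \<and> 0 \<le> t + k}"
  shows "lag_error S N k \<in> borel_measurable M"
  unfolding lag_error_def[abs_def]
proof (intro borel_measurable_sum)
  fix n t assume "t \<in> S"
  then have [simp]: "0 \<le> t" "0 \<le> t + k" using assms by auto
  show "(\<lambda>\<omega>. y n (t + k) \<omega> * cnj (y n t \<omega>) - \<gamma> k) \<in> borel_measurable M" by measurable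
qed

lemma lag_error_polarization:
  assumes S: "finite S" "S \<subseteq> {t. 0 \<le> t \<and> 0 \<le> t + k}"
  shows "4 * lag_error S N k \<omega> =
    (\<Sum>u\<in>{1, -1, \<i>, -\<i>}. u * complex_of_real (\<Sum>n<N. energy_dev S k u n \<omega>))"
proof -
  let ?U = "{1, -1, \<i>, -\<i>}"
  let ?m = "\<lambda>u n t. expectation (\<lambda>\<omega>. (cmod (lag_comb k u n t \<omega>))\<^sup>2)"
  have "4 * (y n (t + k) \<omega> * cnj (y n t \<omega>) - \<gamma> k) =
      (\<Sum>u\<in>?U. u * complex_of_real ((cmod (lag_comb k u n t \<omega>))\<^sup>2 - ?m u n t))" if "t \<in> S" for n t
  proof -
    have t: "0 \<le> t" "0 \<le> t + k" using that S by auto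
    have pol: "4 * (y n (t + k) \<omega> * cnj (y n t \<omega>)) = (\<Sum>u\<in>?U. u * complex_of_real ((cmod (lag_comb k u n t \<omega>))\<^sup>2))" for \<omega>
      unfolding lag_comb_def by (rule polarization_sum)
    have int: "integrable M (\<lambda>\<omega>. (cmod (lag_comb k u n t \<omega>))\<^sup>2)" for u
      using circular_quartic_integrable_norm_power[OF lag_comb_quartic, of t k 2 u n] t by simp
    have "4 * \<gamma> k = expectation (\<lambda>\<omega>. 4 * (y n (t + k) \<omega> * cnj (y n t \<omega>)))"
      using y_covariance[OF t(2) t(1), of n] by simp
    also have "\<dots> = (\<Sum>u\<in>?U. expectation (\<lambda>\<omega>. u * complex_of_real ((cmod (lag_comb k u n t \<omega>))\<^sup>2)))"
      unfolding pol using int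
      by (intro Bochner_Integration.integral_sum integrable_mult_right integrable_of_real)
    also have "\<dots> = (\<Sum>u\<in>?U. u * complex_of_real (?m u n t))"
      by (simp only: integral_mult_right_zero integral_complex_of_real)
    finally show ?thesis
      unfolding right_diff_distrib pol of_real_diff sum_subtractf by (rule arg_cong2[where f = minus, OF refl])
  qed
  then have "4 * lag_error S N k \<omega> =
      (\<Sum>n<N. \<Sum>t\<in>S. \<Sum>u\<in>?U. u * complex_of_real ((cmod (lag_comb k u n t \<omega>))\<^sup>2 - ?m u n t))"
    by (simp add: lag_error_def sum_distrib_left del: of_real_diff)
  also have "\<dots> = (\<Sum>n<N. \<Sum>u\<in>?U. \<Sum>t\<in>S. u * complex_of_real ((cmod (lag_comb k u n t \<omega>))\<^sup>2 - ?m u n t))"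
    by (subst sum.swap) (rule refl)
  also have "\<dots> = (\<Sum>u\<in>?U. \<Sum>n<N. \<Sum>t\<in>S. u * complex_of_real ((cmod (lag_comb k u n t \<omega>))\<^sup>2 - ?m u n t))"
    by (rule sum.swap)
  finally show ?thesis
    by (simp only: energy_dev_def of_real_sum sum_distrib_left)
qed

lemma lag_error_moments:
  fixes K C :: real
  assumes K: "\<And>T. (\<Sum>k=1 - int T..int T - 1. cmod (r k)) \<le> K"
    and C: "C \<ge> 0" "\<And>n t. t \<ge> 0 \<Longrightarrow> expectation (\<lambda>\<omega>. cmod (y n t \<omega>) ^ 8) \<le> C"
    and S: "finite S" "S \<subseteq> {t. 0 \<le> t \<and> 0 \<le> t + k}" and N: "N \<ge> 1"
  defines "s \<equiv> 16 * (vx * K + vw)\<^sup>2 * card S"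
    and "q \<equiv> 16 * (2 ^ 9 * C + (1 + 2 ^ 9 * C) ^ 4) * card S ^ 4"
  shows "integrable M (\<lambda>\<omega>. cmod (lag_error S N k \<omega>) ^ 4)"
    and "expectation (\<lambda>\<omega>. (cmod (lag_error S N k \<omega>))\<^sup>2) \<le> N * s"
    and "expectation (\<lambda>\<omega>. cmod (lag_error S N k \<omega>) ^ 4) \<le> N * q + 3 * (real N)\<^sup>2 * s\<^sup>2"
proof -
  let ?U = "{1, -1, \<i>, -\<i>}"
  define W where "W = (\<lambda>u \<omega>. \<Sum>n<N. energy_dev S k u n \<omega>)"
  have card: "card ?U = 4"
    by (simp add: complex_eq_iff)
  have unit: "cmod u = 1" if "u \<in> ?U" for u using that by auto
  have W: "integrable M (\<lambda>\<omega>. W u \<omega> ^ 4)" "expectation (\<lambda>\<omega>. (W u \<omega>)\<^sup>2) \<le> N * s"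
      "expectation (\<lambda>\<omega>. W u \<omega> ^ 4) \<le> N * q + 3 * (real N)\<^sup>2 * s\<^sup>2" if "u \<in> ?U" for u
    using indep_sum_moments[OF finite_lessThan indep_vars_energy_dev[OF S N, of u], of s q]
      energy_dev_mean_variance[OF K S unit[OF that]] energy_dev_fourth_moment[OF C S unit[OF that]]
    by (auto simp: W_def s_def q_def)
  have intW2: "integrable M (\<lambda>\<omega>. (W u \<omega>)\<^sup>2)" if "u \<in> ?U" for u
  proof -
    have "random_variable borel (energy_dev S k u n)" if "n < N" for n
      using indep_vars_energy_dev[OF S N, of u] that by (auto simp: indep_vars_def)
    then have "W u \<in> borel_measurable M" unfolding W_def by (intro borel_measurable_sum) auto
    from integrable_lower_power[OF this, of 4 2] W(1)[OF that] show ?thesis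
      by (simp add: power_even_abs)
  qed
  have norm_D: "4 * cmod (lag_error S N k \<omega>) \<le> (\<Sum>u\<in>?U. \<bar>W u \<omega>\<bar>)" for \<omega>
  proof -
    have pol: "4 * lag_error S N k \<omega> = (\<Sum>u\<in>?U. u * complex_of_real (W u \<omega>))"
      unfolding W_def by (rule lag_error_polarization[OF S])
    have "4 * cmod (lag_error S N k \<omega>) = cmod (4 * lag_error S N k \<omega>)" by (simp add: norm_mult)
    also have "\<dots> \<le> (\<Sum>u\<in>?U. \<bar>W u \<omega>\<bar>)"
      unfolding pol
      by (rule order_trans[OF norm_sum sum_mono]) (use unit in \<open>auto simp: norm_mult\<close>)
    finally show ?thesis .
  qed
  have D2: "(cmod (lag_error S N k \<omega>))\<^sup>2 \<le> (\<Sum>u\<in>?U. (W u \<omega>)\<^sup>2) / 4" for \<omega>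
  proof -
    have "(4 * cmod (lag_error S N k \<omega>))\<^sup>2 \<le> (\<Sum>u\<in>?U. \<bar>W u \<omega>\<bar>)\<^sup>2"
      using norm_D by (intro power_mono) auto
    also have "\<dots> \<le> (\<Sum>u\<in>?U. \<bar>W u \<omega>\<bar>\<^sup>2) * card ?U" by (rule sum_squared_le_sum_of_squares)
    finally show ?thesis unfolding card power2_abs by (simp add: power_mult_distrib)
  qed
  have D4: "cmod (lag_error S N k \<omega>) ^ 4 \<le> (\<Sum>u\<in>?U. W u \<omega> ^ 4) / 4" for \<omega>
  proof -
    have "(4 * cmod (lag_error S N k \<omega>)) ^ 4 \<le> (\<Sum>u\<in>?U. \<bar>W u \<omega>\<bar>) ^ 4"
      using norm_D by (intro power_mono) auto
    also have "\<dots> \<le> card ?U ^ 3 * (\<Sum>u\<in>?U. \<bar>W u \<omega>\<bar> ^ 4)" by (rule sum_power4_le)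
    finally show ?thesis unfolding card by (simp add: power_mult_distrib power_even_abs)
  qed
  note [measurable] = lag_error_measurable[OF S(2), of N]
  have int4: "integrable M (\<lambda>\<omega>. (\<Sum>u\<in>?U. W u \<omega> ^ 4) / 4)"
    and int2: "integrable M (\<lambda>\<omega>. (\<Sum>u\<in>?U. (W u \<omega>)\<^sup>2) / 4)"
    using W(1) intW2 by (intro integrable_divide Bochner_Integration.integrable_sum; blast)+
  show D: "integrable M (\<lambda>\<omega>. cmod (lag_error S N k \<omega>) ^ 4)"
  proof (rule Bochner_Integration.integrable_bound[OF int4])
    have "norm (cmod (lag_error S N k \<omega>) ^ 4) \<le> norm ((\<Sum>u\<in>?U. W u \<omega> ^ 4) / 4)" for \<omega>
      unfolding real_norm_def by (subst abs_of_nonneg, simp) (rule order_trans[OF D4 abs_ge_self])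
    then show "AE \<omega> in M. norm (cmod (lag_error S N k \<omega>) ^ 4) \<le> norm ((\<Sum>u\<in>?U. W u \<omega> ^ 4) / 4)"
      by (rule AE_I2)
  qed simp
  have "expectation (\<lambda>\<omega>. (cmod (lag_error S N k \<omega>))\<^sup>2) \<le> expectation (\<lambda>\<omega>. (\<Sum>u\<in>?U. (W u \<omega>)\<^sup>2) / 4)"
    using integrable_lower_power[OF _ D, of 2] by (intro integral_mono int2 D2) auto
  also have "\<dots> = (\<Sum>u\<in>?U. expectation (\<lambda>\<omega>. (W u \<omega>)\<^sup>2)) / 4"
    using intW2 by (subst integral_divide_zero, subst Bochner_Integration.integral_sum) auto
  also have "\<dots> \<le> (\<Sum>u\<in>?U. N * s) / 4"
    using W(2) by (intro divide_right_mono sum_mono) auto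
  finally show "expectation (\<lambda>\<omega>. (cmod (lag_error S N k \<omega>))\<^sup>2) \<le> N * s"
    unfolding sum_constant card by simp
  have "expectation (\<lambda>\<omega>. cmod (lag_error S N k \<omega>) ^ 4) \<le> expectation (\<lambda>\<omega>. (\<Sum>u\<in>?U. W u \<omega> ^ 4) / 4)"
    by (intro integral_mono int4 D D4)
  also have "\<dots> = (\<Sum>u\<in>?U. expectation (\<lambda>\<omega>. W u \<omega> ^ 4)) / 4"
    using W(1) by (subst integral_divide_zero, subst Bochner_Integration.integral_sum) auto
  also have "\<dots> \<le> (\<Sum>u\<in>?U. N * q + 3 * (real N)\<^sup>2 * s\<^sup>2) / 4"
    using W(3) by (intro divide_right_mono sum_mono) auto
  finally show "expectation (\<lambda>\<omega>. cmod (lag_error S N k \<omega>) ^ 4) \<le> N * q + 3 * (real N)\<^sup>2 * s\<^sup>2"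
    unfolding sum_constant card by simp
qed

definition lag_window :: "nat \<Rightarrow> int \<Rightarrow> int set" where
  "lag_window T k = {t. 0 \<le> t \<and> t \<le> int T - 1 \<and> 0 \<le> t + k \<and> t + k \<le> int T - 1}"

lemma lag_window:
  shows "finite (lag_window T k)" "lag_window T k \<subseteq> {t. 0 \<le> t \<and> 0 \<le> t + k}"
    and "\<bar>k\<bar> \<le> int T \<Longrightarrow> real (card (lag_window T k)) = real T - \<bar>real_of_int k\<bar>"
proof -
  have eq: "lag_window T k = {max 0 (- k)..min (int T - 1) (int T - 1 - k)}"
    by (auto simp: lag_window_def)
  show "finite (lag_window T k)" unfolding eq by simp
  show "lag_window T k \<subseteq> {t. 0 \<le> t \<and> 0 \<le> t + k}" by (auto simp: lag_window_def)
  show "real (card (lag_window T k)) = real T - \<bar>real_of_int k\<bar>" if "\<bar>k\<bar> \<le> int T"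
    unfolding eq using that by (auto simp: min_def max_def)
qed

lemma lag_sum_eq:
  "lag_sum N T (\<lambda>n t. y n t \<omega>) k =
    lag_error (lag_window T k) N k \<omega> + N * card (lag_window T k) * \<gamma> k"
  by (simp add: lag_sum_def lag_error_def lag_window_def sum_subtractf)

lemma r_estimate_error:
  assumes N: "N \<ge> 1" and T: "T > p" and k: "\<bar>k\<bar> \<le> int p"
  defines "D \<equiv> lag_error (lag_window T k) N k"
  shows "r_biased vx vw N T (\<lambda>n t. y n t \<omega>) k - r k =
      D \<omega> / complex_of_real (vx * N * T) - complex_of_real (\<bar>real_of_int k\<bar> / T) * r k"
    and "r_unbiased vx vw N T (\<lambda>n t. y n t \<omega>) k - r k =
      D \<omega> / complex_of_real (vx * N * (T - \<bar>real_of_int k\<bar>))"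
proof -
  let ?y = "\<lambda>n t. y n t \<omega>"
  have card: "real (card (lag_window T k)) = real T - \<bar>real_of_int k\<bar>"
    using k T by (intro lag_window(3)) simp
  then have ccard: "of_nat (card (lag_window T k)) = complex_of_real (real T - \<bar>real_of_int k\<bar>)"
    by (metis of_real_of_nat_eq)
  have pos: "0 < real T" "0 < real T - \<bar>real_of_int k\<bar>" "0 < real N" using k T N by linarith+
  have sum: "lag_sum N T ?y k = D \<omega> + N * (complex_of_real (T - \<bar>real_of_int k\<bar>) * \<gamma> k)"
    unfolding lag_sum_eq D_def[symmetric] by (simp add: ccard del: of_real_diff)
  have zero: "complex_of_real (r_zero vx vw N T ?y) - r k = D \<omega> / complex_of_real (vx * N * T)" if "k = 0"
  proof -
    have "(\<Sum>n<N. \<Sum>t=0..int T - 1. complex_of_real ((cmod (?y n t))\<^sup>2)) = lag_sum N T ?y 0"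
      unfolding lag_sum_def by (intro sum.cong) (auto simp only: complex_norm_square add_0_right atLeastAtMost_iff mem_Collect_eq)
    then have "complex_of_real (r_zero vx vw N T ?y) =
        (D \<omega> + N * (of_nat T * (vx * r 0 + vw))) / complex_of_real (vx * N * T) - complex_of_real (vw / vx)"
      using sum that by (simp add: r_zero_def \<gamma>_def)
    moreover have "(d + n * (t * (v * c + e))) / (v * n * t) - e / v - c = d / (v * n * t)"
      if "v \<noteq> 0" "n \<noteq> 0" "t \<noteq> 0" for d n t v c e :: complex
      using that by (simp add: field_simps)
    ultimately show ?thesis using vx_pos pos that by simp
  qed
  show "r_biased vx vw N T ?y k - r k =
      D \<omega> / complex_of_real (vx * N * T) - complex_of_real (\<bar>real_of_int k\<bar> / T) * r k"
  proof (cases "k = 0")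
    case True
    then show ?thesis using zero by (simp add: r_biased_def)
  next
    case False
    then have "r_biased vx vw N T ?y k - r k =
        (D \<omega> + N * (complex_of_real (T - \<bar>real_of_int k\<bar>) * (vx * r k))) / complex_of_real (vx * N * T) - r k"
      using sum by (simp add: r_biased_def \<gamma>_def)
    then show ?thesis using vx_pos pos by (simp add: field_simps)
  qed
  show "r_unbiased vx vw N T ?y k - r k = D \<omega> / complex_of_real (vx * N * (T - \<bar>real_of_int k\<bar>))"
  proof (cases "k = 0")
    case True
    then show ?thesis using zero by (simp add: r_unbiased_def)
  next
    case False
    have nz: "complex_of_real (T - \<bar>real_of_int k\<bar>) \<noteq> 0" using pos by (simp only: of_real_eq_0_iff)
    have "r_unbiased vx vw N T ?y k - r k =
        (D \<omega> + N * (complex_of_real (T - \<bar>real_of_int k\<bar>) * (vx * r k))) /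
          complex_of_real (vx * N * (T - \<bar>real_of_int k\<bar>)) - r k"
      using sum False by (simp add: r_unbiased_def \<gamma>_def)
    then show ?thesis using vx_pos pos nz by (simp add: add_divide_distrib del: of_real_diff)
  qed
qed

text \<open>A common bound for the errors of the biased and the unbiased estimate of \<open>r k\<close>: the factor
  2 covers the denominator \<open>T - |k| \<ge> T / 2\<close> and the term \<open>b / T\<close> the bias.\<close>

definition err_bound :: "nat \<Rightarrow> nat \<Rightarrow> real \<Rightarrow> int \<Rightarrow> 'a \<Rightarrow> real" where
  "err_bound N T b k \<omega> = 2 / (vx * N * T) * cmod (lag_error (lag_window T k) N k \<omega>) + b / T"

lemma r_estimate_error_le:
  fixes K :: real
  assumes N: "N \<ge> 1" and T: "T > p" "T \<ge> 2 * p" and k: "\<bar>k\<bar> \<le> int p" and K: "cmod (r k) \<le> K"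
  shows "cmod (r_biased vx vw N T (\<lambda>n t. y n t \<omega>) k - r k) \<le> err_bound N T (p * K) k \<omega>"
    and "cmod (r_unbiased vx vw N T (\<lambda>n t. y n t \<omega>) k - r k) \<le> err_bound N T (p * K) k \<omega>"
proof -
  define d where "d = cmod (lag_error (lag_window T k) N k \<omega>)"
  have "0 \<le> K" using K norm_ge_zero order_trans by blast
  have pos: "0 < real T" "0 < real N" "0 \<le> d" using T N by (auto simp: d_def)
  have k': "\<bar>real_of_int k\<bar> \<le> real p" using k by linarith
  then have T2: "0 < real T - \<bar>real_of_int k\<bar>" "real T \<le> 2 * (real T - \<bar>real_of_int k\<bar>)"
    using T(1) of_nat_mono[OF T(2), where ?'a = real] by simp_all
  have "cmod (r_biased vx vw N T (\<lambda>n t. y n t \<omega>) k - r k) \<le>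
      d / (vx * N * T) + \<bar>real_of_int k\<bar> / T * cmod (r k)"
    unfolding r_estimate_error(1)[OF N T(1) k]
    using vx_pos by (intro order_trans[OF norm_triangle_ineq4]) (simp add: norm_mult norm_divide d_def)
  also have "\<dots> \<le> 2 * d / (vx * N * T) + p / T * K"
    using vx_pos pos K k' \<open>0 \<le> K\<close>
    by (intro add_mono divide_right_mono mult_mono) auto
  finally show "cmod (r_biased vx vw N T (\<lambda>n t. y n t \<omega>) k - r k) \<le> err_bound N T (p * K) k \<omega>"
    by (simp add: err_bound_def d_def)
  have "cmod (r_unbiased vx vw N T (\<lambda>n t. y n t \<omega>) k - r k) = d / (vx * N * (T - \<bar>real_of_int k\<bar>))"
    unfolding r_estimate_error(2)[OF N T(1) k]
    using vx_pos T2 by (simp add: norm_divide norm_mult d_def del: of_real_diff)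
  also have "\<dots> \<le> d / (vx * N * (T / 2))"
    using vx_pos pos T2 by (intro divide_left_mono mult_left_mono) (auto intro!: mult_pos_pos)
  also have "\<dots> = 2 * d / (vx * N * T)" by simp
  also have "\<dots> \<le> 2 * d / (vx * N * T) + p / T * K"
    using pos \<open>0 \<le> K\<close> by simp
  finally show "cmod (r_unbiased vx vw N T (\<lambda>n t. y n t \<omega>) k - r k) \<le> err_bound N T (p * K) k \<omega>"
    by (simp add: err_bound_def d_def)
qed

lemma err_bound_measurable [measurable]: "err_bound N T b k \<in> borel_measurable M"
  using lag_error_measurable[OF lag_window(2)] unfolding err_bound_def[abs_def] by measurable

lemma err_bound_moments:
  fixes K C b :: real
  assumes K: "\<And>T. (\<Sum>k=1 - int T..int T - 1. cmod (r k)) \<le> K"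
    and C: "C \<ge> 0" "\<And>n t. t \<ge> 0 \<Longrightarrow> expectation (\<lambda>\<omega>. cmod (y n t \<omega>) ^ 8) \<le> C"
    and NT: "N \<ge> 1" "T \<ge> 1" and k: "\<bar>k\<bar> \<le> int T" and b: "b \<ge> 0"
  defines "G2 \<equiv> 16 * (vx * K + vw)\<^sup>2" and "Q \<equiv> 16 * (2 ^ 9 * C + (1 + 2 ^ 9 * C) ^ 4)"
  shows "integrable M (\<lambda>\<omega>. (err_bound N T b k \<omega>)\<^sup>2)" "integrable M (\<lambda>\<omega>. err_bound N T b k \<omega> ^ 4)"
    and "expectation (\<lambda>\<omega>. (err_bound N T b k \<omega>)\<^sup>2) \<le> 16 * G2 / vx\<^sup>2 / (real N * real T) + 4 * b\<^sup>2 / (real T)\<^sup>2"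
    and "expectation (\<lambda>\<omega>. err_bound N T b k \<omega> ^ 4) \<le>
      16 * (16 / vx ^ 4 * (Q * (T / (real N)\<^sup>2) + 3 * G2\<^sup>2 * (1 / (real N * real T))) + b ^ 4 * (N / real T ^ 3)) / (real N * real T)"
proof -
  define S where "S = lag_window T k"
  define D where "D = (\<lambda>\<omega>. cmod (lag_error S N k \<omega>))"
  define e where "e = 2 / (vx * N * T)"
  have E: "err_bound N T b k \<omega> = e * D \<omega> + b / T" for \<omega>
    by (simp add: err_bound_def e_def D_def S_def)
  have e: "e \<ge> 0" using vx_pos by (simp add: e_def)
  have pos: "0 < real N" "0 < real T" using NT by auto
  have [measurable]: "D \<in> borel_measurable M"
    using lag_error_measurable[OF lag_window(2)] unfolding D_def S_def by measurable
  have card: "real (card S) \<le> T"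
    using lag_window(3)[OF k] by (simp add: S_def)
  note mom = lag_error_moments[OF K C lag_window(1,2)[of T k] NT(1), folded S_def, folded D_def G2_def Q_def]
  have D4: "integrable M (\<lambda>\<omega>. D \<omega> ^ 4)" using mom(1) by (simp add: D_def)
  have D2: "integrable M (\<lambda>\<omega>. (D \<omega>)\<^sup>2)"
    using integrable_lower_power[of D 4 2] D4 by (simp add: power_even_abs)
  have "G2 \<ge> 0" "Q \<ge> 0" using C(1) by (auto simp: G2_def Q_def)
  have ED2: "expectation (\<lambda>\<omega>. (D \<omega>)\<^sup>2) \<le> N * (G2 * T)"
    using mom(2) mult_left_mono[OF card \<open>G2 \<ge> 0\<close>] pos
    by (auto simp: D_def intro: order_trans[OF _ mult_left_mono])
  have ED4: "expectation (\<lambda>\<omega>. D \<omega> ^ 4) \<le> N * (Q * real T ^ 4) + 3 * (real N)\<^sup>2 * (G2 * T)\<^sup>2"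
  proof -
    have "N * (Q * real (card S ^ 4)) + 3 * (real N)\<^sup>2 * (G2 * card S)\<^sup>2 \<le>
        N * (Q * real T ^ 4) + 3 * (real N)\<^sup>2 * (G2 * T)\<^sup>2"
      unfolding of_nat_power using card \<open>G2 \<ge> 0\<close> \<open>Q \<ge> 0\<close>
      by (intro add_mono mult_left_mono power_mono) auto
    then show ?thesis using mom(3) by (simp add: D_def)
  qed
  have le: "(err_bound N T b k \<omega>) ^ j \<le> 2 ^ j * (e ^ j * D \<omega> ^ j + (b / T) ^ j)" for \<omega> j
    unfolding E using power_add_le[of "e * D \<omega>" "b / T" j] e b by (simp add: D_def power_mult_distrib)
  have nonneg: "0 \<le> err_bound N T b k \<omega>" for \<omega>
    unfolding E using e b by (simp add: D_def)
  have int: "integrable M (\<lambda>\<omega>. (err_bound N T b k \<omega>) ^ j)"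
    if "integrable M (\<lambda>\<omega>. D \<omega> ^ j)" for j
  proof (rule Bochner_Integration.integrable_bound)
    show "integrable M (\<lambda>\<omega>. 2 ^ j * (e ^ j * D \<omega> ^ j + (b / T) ^ j))" using that by simp
    show "AE \<omega> in M. norm (err_bound N T b k \<omega> ^ j) \<le> norm (2 ^ j * (e ^ j * D \<omega> ^ j + (b / T) ^ j))"
      using le nonneg by (intro AE_I2) (auto simp: power_abs intro: order_trans[OF _ abs_ge_self])
  qed simp
  have expect: "expectation (\<lambda>\<omega>. (err_bound N T b k \<omega>) ^ j) \<le>
      2 ^ j * (e ^ j * expectation (\<lambda>\<omega>. D \<omega> ^ j) + (b / T) ^ j)"
    if "integrable M (\<lambda>\<omega>. D \<omega> ^ j)" for j
  proof -
    have "expectation (\<lambda>\<omega>. (err_bound N T b k \<omega>) ^ j) \<le> expectation (\<lambda>\<omega>. 2 ^ j * (e ^ j * D \<omega> ^ j + (b / T) ^ j))"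
      using int[OF that] that le by (intro integral_mono) auto
    then show ?thesis using that by (simp add: prob_space)
  qed
  show "integrable M (\<lambda>\<omega>. (err_bound N T b k \<omega>)\<^sup>2)" "integrable M (\<lambda>\<omega>. err_bound N T b k \<omega> ^ 4)"
    using int D2 D4 by auto
  have "expectation (\<lambda>\<omega>. (err_bound N T b k \<omega>)\<^sup>2) \<le> 2\<^sup>2 * (e\<^sup>2 * (N * (G2 * T)) + (b / T)\<^sup>2)"
    by (rule order_trans[OF expect[OF D2]]) (intro mult_left_mono add_mono ED2; simp)
  also have "\<dots> = 16 * G2 / vx\<^sup>2 / (real N * real T) + 4 * b\<^sup>2 / (real T)\<^sup>2"
    using pos vx_pos by (simp add: e_def field_simps power2_eq_square)
  finally show "expectation (\<lambda>\<omega>. (err_bound N T b k \<omega>)\<^sup>2) \<le> 16 * G2 / vx\<^sup>2 / (real N * real T) + 4 * b\<^sup>2 / (real T)\<^sup>2" .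
  have "expectation (\<lambda>\<omega>. err_bound N T b k \<omega> ^ 4) \<le>
      2 ^ 4 * (e ^ 4 * (N * (Q * real T ^ 4) + 3 * (real N)\<^sup>2 * (G2 * T)\<^sup>2) + (b / T) ^ 4)"
    by (rule order_trans[OF expect[OF D4]]) (intro mult_left_mono add_mono ED4; simp)
  also have "\<dots> = 16 * (16 / vx ^ 4 * (Q * (T / (real N)\<^sup>2) + 3 * G2\<^sup>2 * (1 / (real N * real T))) + b ^ 4 * (N / real T ^ 3)) / (real N * real T)"
  proof -
    have "e ^ 4 * (N * (Q * real T ^ 4)) = 16 / vx ^ 4 * (Q * (T / (real N)\<^sup>2)) / (real N * real T)"
      using pos vx_pos by (simp add: e_def field_simps power2_eq_square power4_eq_xxxx)
    moreover have "e ^ 4 * (3 * (real N)\<^sup>2 * (G2 * T)\<^sup>2) = 16 / vx ^ 4 * (3 * G2\<^sup>2 * (1 / (real N * real T))) / (real N * real T)"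
      using pos vx_pos by (simp add: e_def field_simps power2_eq_square power4_eq_xxxx)
    moreover have "(b / T) ^ 4 = b ^ 4 * (N / real T ^ 3) / (real N * real T)"
      using pos by (simp add: field_simps power3_eq_cube power4_eq_xxxx)
    ultimately show ?thesis by (simp add: distrib_left add_divide_distrib)
  qed
  finally show "expectation (\<lambda>\<omega>. err_bound N T b k \<omega> ^ 4) \<le>
      16 * (16 / vx ^ 4 * (Q * (T / (real N)\<^sup>2) + 3 * G2\<^sup>2 * (1 / (real N * real T))) + b ^ 4 * (N / real T ^ 3)) / (real N * real T)" .
qed

lemma estimator_tail:
  fixes K :: real
  assumes K: "\<And>k. cmod (r k) \<le> K" and inv: "invertible_mat (toeplitz p r)"
  obtains C \<delta>\<^sub>0 :: real where "C > 0" "\<delta>\<^sub>0 > 0"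
    "\<And>N T \<theta> \<epsilon> i. N \<ge> 1 \<Longrightarrow> T > p \<Longrightarrow> T \<ge> 2 * p \<Longrightarrow> \<theta> \<le> \<delta>\<^sub>0 \<Longrightarrow> C * \<theta> \<le> \<epsilon> \<Longrightarrow> i \<in> {1..p} \<Longrightarrow>
      \<P>(\<omega> in M. cmod (ar_est_biased p vx vw N T (\<lambda>n t. y n t \<omega>) i - a i) > \<epsilon>) \<le>
        (\<Sum>k=-int p..int p. \<P>(\<omega> in M. \<theta> \<le> err_bound N T (p * K) k \<omega>)) \<and>
      \<P>(\<omega> in M. cmod (ar_est_unbiased p vx vw N T (\<lambda>n t. y n t \<omega>) i - a i) > \<epsilon>) \<le>
        (\<Sum>k=-int p..int p. \<P>(\<omega> in M. \<theta> \<le> err_bound N T (p * K) k \<omega>))"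
proof -
  obtain C \<delta>\<^sub>0 :: real where C: "C > 0" "\<delta>\<^sub>0 > 0" and
    pert: "\<And>c \<delta> i. \<delta> \<le> \<delta>\<^sub>0 \<Longrightarrow> (\<And>k. \<bar>k\<bar> \<le> int p \<Longrightarrow> cmod (c k - r k) \<le> \<delta>) \<Longrightarrow> i \<in> {1..p} \<Longrightarrow>
        cmod (vec_index (yule_walker p c) (i - 1) - complex_of_real (a i)) \<le> C * \<delta>"
    using yule_walker_perturbation[OF inv, of "\<lambda>j. complex_of_real (a j)"] yule_walker_equations by blast
  have tail: "\<P>(\<omega> in M. cmod (vec_index (yule_walker p (R \<omega>)) (i - 1) - a i) > \<epsilon>) \<le>
      (\<Sum>k=-int p..int p. \<P>(\<omega> in M. \<theta> \<le> err_bound N T (p * K) k \<omega>))"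
    if \<theta>: "\<theta> \<le> \<delta>\<^sub>0" "C * \<theta> \<le> \<epsilon>" and i: "i \<in> {1..p}"
      and R: "\<And>k \<omega>. \<bar>k\<bar> \<le> int p \<Longrightarrow> cmod (R \<omega> k - r k) \<le> err_bound N T (p * K) k \<omega>" for \<theta> \<epsilon> i N T R
  proof -
    let ?A = "\<lambda>k. {\<omega> \<in> space M. \<theta> \<le> err_bound N T (p * K) k \<omega>}"
    have "{\<omega> \<in> space M. cmod (vec_index (yule_walker p (R \<omega>)) (i - 1) - a i) > \<epsilon>} \<subseteq>
        (\<Union>k\<in>{-int p..int p}. ?A k)"
    proof
      fix \<omega> assume "\<omega> \<in> {\<omega> \<in> space M. cmod (vec_index (yule_walker p (R \<omega>)) (i - 1) - a i) > \<epsilon>}"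
      then have \<omega>: "\<omega> \<in> space M" "cmod (vec_index (yule_walker p (R \<omega>)) (i - 1) - a i) > \<epsilon>" by auto
      then have "\<not> (\<forall>k. \<bar>k\<bar> \<le> int p \<longrightarrow> cmod (R \<omega> k - r k) \<le> \<theta>)"
        using pert[OF \<theta>(1) _ i, of "R \<omega>"] \<theta>(2) by fastforce
      then obtain k where k: "\<bar>k\<bar> \<le> int p" "\<theta> < cmod (R \<omega> k - r k)" by (auto simp: not_le)
      then have "\<omega> \<in> ?A k" using \<omega>(1) R[of k \<omega>] by simp
      then show "\<omega> \<in> (\<Union>k\<in>{-int p..int p}. ?A k)" using k(1) by (auto simp: abs_le_iff)
    qed
    then have "\<P>(\<omega> in M. cmod (vec_index (yule_walker p (R \<omega>)) (i - 1) - a i) > \<epsilon>) \<le>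
        prob (\<Union>k\<in>{-int p..int p}. ?A k)"
      by (rule finite_measure_mono) (auto intro!: sets.finite_UN)
    also have "\<dots> \<le> (\<Sum>k=-int p..int p. prob (?A k))"
      by (rule finite_measure_subadditive_finite) auto
    finally show ?thesis .
  qed
  show ?thesis
  proof (rule that[OF C])
    fix N T :: nat and \<theta> \<epsilon> :: real and i
    assume N: "N \<ge> 1" "T > p" "T \<ge> 2 * p" and \<theta>: "\<theta> \<le> \<delta>\<^sub>0" "C * \<theta> \<le> \<epsilon>" and i: "i \<in> {1..p}"
    show "\<P>(\<omega> in M. cmod (ar_est_biased p vx vw N T (\<lambda>n t. y n t \<omega>) i - a i) > \<epsilon>) \<le>
        (\<Sum>k=-int p..int p. \<P>(\<omega> in M. \<theta> \<le> err_bound N T (p * K) k \<omega>)) \<and>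
      \<P>(\<omega> in M. cmod (ar_est_unbiased p vx vw N T (\<lambda>n t. y n t \<omega>) i - a i) > \<epsilon>) \<le>
        (\<Sum>k=-int p..int p. \<P>(\<omega> in M. \<theta> \<le> err_bound N T (p * K) k \<omega>))"
      unfolding ar_est_biased_def ar_est_unbiased_def
      using r_estimate_error_le[OF N _ K] by (intro conjI tail[OF \<theta> i]) auto
  qed
qed

end

theorem theorem1:
  fixes M :: "'a measure" and p :: nat and a :: "nat \<Rightarrow> real" and vx vw K c :: real
    and h x w :: "nat \<Rightarrow> int \<Rightarrow> 'a \<Rightarrow> complex"
  defines "r \<equiv> autocov M vx (h 0)"
    and "obs \<equiv> (\<lambda>\<omega> n t. h n t \<omega> + w n t \<omega>)"
  assumes model: "ar_observation_model M p a vx vw h x w"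
    and K_pos: "K > 0"
    and r_summable: "\<And>T. (\<Sum>k=1 - int T..int T - 1. cmod (r k)) \<le> K"
    and R_inv: "invertible_mat (toeplitz p r)"
    and c_pos: "c > 0"
  shows "\<exists>K''>0. \<forall>N T. joint_regime p c N T \<longrightarrow>
           (\<forall>i\<in>{1..p}. \<forall>\<epsilon>\<^sub>0>0. \<forall>\<^sub>F m in sequentially. \<forall>\<epsilon>. 0 < \<epsilon> \<and> \<epsilon> \<le> \<epsilon>\<^sub>0 \<longrightarrow>
              \<P>(\<omega> in M. cmod (ar_est_biased p vx vw (N m) (T m) (obs \<omega>) i - complex_of_real (a i)) > \<epsilon>)
                \<le> K'' / (\<epsilon>\<^sup>2 * real (N m) * real (T m)) \<and>
              \<P>(\<omega> in M. cmod (ar_est_unbiased p vx vw (N m) (T m) (obs \<omega>) i - complex_of_real (a i)) > \<epsilon>)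
                \<le> K'' / (\<epsilon>\<^sup>2 * real (N m) * (real (T m) - real i)))"
proof -
  interpret ar_observation_model M p a vx vw h x w by (rule model)
  note K = r_summable[unfolded r_def]
  have K_bound: "cmod (autocov M vx (h 0) k) \<le> K" for k
  proof -
    let ?I = "{1 - int (Suc (nat \<bar>k\<bar>))..int (Suc (nat \<bar>k\<bar>)) - 1}"
    have "k \<in> ?I" by auto
    then show ?thesis
      using member_le_sum[of k ?I "\<lambda>k. cmod (autocov M vx (h 0) k)"] K[of "Suc (nat \<bar>k\<bar>)"] by force
  qed
  obtain C8 :: real where C8: "C8 \<ge> 0"
      "\<And>n t. t \<ge> 0 \<Longrightarrow> expectation (\<lambda>\<omega>. cmod (h n t \<omega> + w n t \<omega>) ^ 8) \<le> C8"
    using y_moment8 by blast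
  obtain C \<delta>\<^sub>0 :: real where C: "C > 0" and \<delta>\<^sub>0: "\<delta>\<^sub>0 > 0"
    and tail: "\<And>N T \<theta> \<epsilon> i. N \<ge> 1 \<Longrightarrow> T > p \<Longrightarrow> T \<ge> 2 * p \<Longrightarrow> \<theta> \<le> \<delta>\<^sub>0 \<Longrightarrow> C * \<theta> \<le> \<epsilon> \<Longrightarrow> i \<in> {1..p} \<Longrightarrow>
      \<P>(\<omega> in M. cmod (ar_est_biased p vx vw N T (\<lambda>n t. h n t \<omega> + w n t \<omega>) i - a i) > \<epsilon>) \<le>
        (\<Sum>k=-int p..int p. \<P>(\<omega> in M. \<theta> \<le> err_bound N T (p * K) k \<omega>)) \<and>
      \<P>(\<omega> in M. cmod (ar_est_unbiased p vx vw N T (\<lambda>n t. h n t \<omega> + w n t \<omega>) i - a i) > \<epsilon>) \<le>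
        (\<Sum>k=-int p..int p. \<P>(\<omega> in M. \<theta> \<le> err_bound N T (p * K) k \<omega>))"
    using estimator_tail[OF K_bound R_inv[unfolded r_def]] by blast
  define b where "b = real p * K"
  define G2 where "G2 = 16 * (vx * K + vw)\<^sup>2"
  define Q where "Q = 16 * (2 ^ 9 * C8 + (1 + 2 ^ 9 * C8) ^ 4)"
  define L where "L = 2 * real p + 1"
  define A where "A = 16 * G2 / vx\<^sup>2 + 8 * c * b\<^sup>2"
  define K'' where "K'' = L * C\<^sup>2 * A + 1"
  define q where "q = (\<lambda>N T. 16 * (16 / vx ^ 4 * (Q * (real T / (real N)\<^sup>2) + 3 * G2\<^sup>2 * (1 / (real N * real T))) +
      b ^ 4 * (real N / real T ^ 3)))"
  have nonneg: "b \<ge> 0" "G2 \<ge> 0" "L > 0" "A \<ge> 0"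
    using K_pos c_pos by (auto simp: b_def G2_def L_def A_def)
  then have "K'' \<ge> 1" by (simp add: K''_def)
  have card: "real (card {- int p..int p}) = L" by (simp add: L_def)
  have tail2: "(\<Sum>k=-int p..int p. \<P>(\<omega> in M. \<theta> \<le> err_bound N T b k \<omega>)) \<le> L * (A / (real N * real T) / \<theta>\<^sup>2)"
    and tail4: "(\<Sum>k=-int p..int p. \<P>(\<omega> in M. \<theta> \<le> err_bound N T b k \<omega>)) \<le> L * (q N T / (real N * real T) / \<theta> ^ 4)"
    if N: "N \<ge> 1" and T: "T > p" and NT: "real N / real T \<le> 2 * c" and \<theta>: "\<theta> > 0" for N T \<theta>
  proof -
    have pos: "0 < real N" "0 < real T" using N T by auto
    have markov: "\<P>(\<omega> in M. \<theta> \<le> err_bound N T b k \<omega>) \<le> expectation (\<lambda>\<omega>. err_bound N T b k \<omega> ^ j) / \<theta> ^ j"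
      if "even j" "integrable M (\<lambda>\<omega>. err_bound N T b k \<omega> ^ j)" for k j
    proof -
      have "\<P>(\<omega> in M. \<theta> \<le> err_bound N T b k \<omega>) \<le> \<P>(\<omega> in M. \<theta> ^ j \<le> err_bound N T b k \<omega> ^ j)"
        using \<theta> by (intro finite_measure_mono) (auto intro: power_mono)
      also have "\<dots> \<le> expectation (\<lambda>\<omega>. err_bound N T b k \<omega> ^ j) / \<theta> ^ j"
        using \<theta> that by (intro integral_Markov_inequality_measure[where A = "{}"]) (auto simp: zero_le_even_power)
      finally show ?thesis .
    qed
    have T1: "T \<ge> 1" using T by simp
    have k: "\<bar>k\<bar> \<le> int T" if "k \<in> {- int p..int p}" for k using that T by auto
    have mom: "integrable M (\<lambda>\<omega>. (err_bound N T b k \<omega>)\<^sup>2)" "integrable M (\<lambda>\<omega>. err_bound N T b k \<omega> ^ 4)"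
        "expectation (\<lambda>\<omega>. (err_bound N T b k \<omega>)\<^sup>2) \<le> 16 * G2 / vx\<^sup>2 / (real N * real T) + 4 * b\<^sup>2 / (real T)\<^sup>2"
        "expectation (\<lambda>\<omega>. err_bound N T b k \<omega> ^ 4) \<le> q N T / (real N * real T)"
      if "k \<in> {- int p..int p}" for k
      unfolding G2_def Q_def q_def using err_bound_moments[OF K C8 N T1 k[OF that] nonneg(1)] by blast+
    have "1 / (real T)\<^sup>2 \<le> 2 * c / (real N * real T)"
      using NT pos by (simp add: field_simps power2_eq_square)
    then have "4 * b\<^sup>2 * (1 / (real T)\<^sup>2) \<le> 4 * b\<^sup>2 * (2 * c / (real N * real T))"
      by (rule mult_left_mono) simp
    then have A: "16 * G2 / vx\<^sup>2 / (real N * real T) + 4 * b\<^sup>2 / (real T)\<^sup>2 \<le> A / (real N * real T)"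
      by (simp add: A_def add_divide_distrib mult_ac)
    have "(\<Sum>k=-int p..int p. \<P>(\<omega> in M. \<theta> \<le> err_bound N T b k \<omega>)) \<le>
        (\<Sum>k=-int p..int p. A / (real N * real T) / \<theta>\<^sup>2)"
    proof (rule sum_mono)
      fix k assume k: "k \<in> {- int p..int p}"
      have "\<P>(\<omega> in M. \<theta> \<le> err_bound N T b k \<omega>) \<le> expectation (\<lambda>\<omega>. (err_bound N T b k \<omega>)\<^sup>2) / \<theta>\<^sup>2"
        using mom(1)[OF k] by (intro markov) auto
      also have "\<dots> \<le> A / (real N * real T) / \<theta>\<^sup>2"
        by (intro divide_right_mono order_trans[OF mom(3)[OF k] A]) simp
      finally show "\<P>(\<omega> in M. \<theta> \<le> err_bound N T b k \<omega>) \<le> A / (real N * real T) / \<theta>\<^sup>2" .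
    qed
    then show "(\<Sum>k=-int p..int p. \<P>(\<omega> in M. \<theta> \<le> err_bound N T b k \<omega>)) \<le> L * (A / (real N * real T) / \<theta>\<^sup>2)"
      unfolding sum_constant card .
    have "(\<Sum>k=-int p..int p. \<P>(\<omega> in M. \<theta> \<le> err_bound N T b k \<omega>)) \<le>
        (\<Sum>k=-int p..int p. q N T / (real N * real T) / \<theta> ^ 4)"
    proof (rule sum_mono)
      fix k assume k: "k \<in> {- int p..int p}"
      have "\<P>(\<omega> in M. \<theta> \<le> err_bound N T b k \<omega>) \<le> expectation (\<lambda>\<omega>. err_bound N T b k \<omega> ^ 4) / \<theta> ^ 4"
        using mom(2)[OF k] by (intro markov) auto
      also have "\<dots> \<le> q N T / (real N * real T) / \<theta> ^ 4"
        by (intro divide_right_mono mom(4)[OF k]) simp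
      finally show "\<P>(\<omega> in M. \<theta> \<le> err_bound N T b k \<omega>) \<le> q N T / (real N * real T) / \<theta> ^ 4" .
    qed
    then show "(\<Sum>k=-int p..int p. \<P>(\<omega> in M. \<theta> \<le> err_bound N T b k \<omega>)) \<le> L * (q N T / (real N * real T) / \<theta> ^ 4)"
      unfolding sum_constant card .
  qed
  have main: "\<forall>\<^sub>F m in sequentially. \<forall>\<epsilon>. 0 < \<epsilon> \<and> \<epsilon> \<le> \<epsilon>\<^sub>0 \<longrightarrow>
      \<P>(\<omega> in M. cmod (ar_est_biased p vx vw (N m) (T m) (obs \<omega>) i - complex_of_real (a i)) > \<epsilon>)
        \<le> K'' / (\<epsilon>\<^sup>2 * real (N m) * real (T m)) \<and>
      \<P>(\<omega> in M. cmod (ar_est_unbiased p vx vw (N m) (T m) (obs \<omega>) i - complex_of_real (a i)) > \<epsilon>)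
        \<le> K'' / (\<epsilon>\<^sup>2 * real (N m) * (real (T m) - real i))"
    if regime: "joint_regime p c N T" and i: "i \<in> {1..p}" and \<epsilon>\<^sub>0: "\<epsilon>\<^sub>0 > 0" for N T i \<epsilon>\<^sub>0
  proof -
    have N: "filterlim N at_top sequentially" and T: "filterlim T at_top sequentially"
      and ratio: "(\<lambda>m. real (N m) / real (T m)) \<longlonglongrightarrow> c" and Tp: "T m > p" for m
      using regime by (auto simp: joint_regime_def)
    have inv: "(\<lambda>m. inverse (real (N m))) \<longlonglongrightarrow> 0" "(\<lambda>m. inverse (real (T m))) \<longlonglongrightarrow> 0"
      using N T by (auto intro!: tendsto_inverse_0_at_top filterlim_compose[OF filterlim_real_sequentially])
    have "(\<lambda>m. 16 * (16 / vx ^ 4 * (Q * (inverse (real (N m) / real (T m)) * inverse (real (N m))) +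
        3 * G2\<^sup>2 * (inverse (real (N m)) * inverse (real (T m)))) +
        b ^ 4 * (real (N m) / real (T m) * (inverse (real (T m)))\<^sup>2)))
      \<longlonglongrightarrow> 16 * (16 / vx ^ 4 * (Q * (inverse c * 0) + 3 * G2\<^sup>2 * (0 * 0)) + b ^ 4 * (c * 0\<^sup>2))"
      using c_pos by (intro tendsto_intros inv ratio) auto
    then have "(\<lambda>m. q (N m) (T m)) \<longlonglongrightarrow> 0"
      by (simp add: q_def field_simps power2_eq_square power3_eq_cube)
    then have "\<forall>\<^sub>F m in sequentially. q (N m) (T m) < \<delta>\<^sub>0 ^ 4 / (L * \<epsilon>\<^sub>0\<^sup>2)"
      using \<delta>\<^sub>0 nonneg(3) \<epsilon>\<^sub>0 by (intro order_tendstoD(2)) auto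
    moreover have "\<forall>\<^sub>F m in sequentially. real (N m) / real (T m) < 2 * c"
      using c_pos by (intro order_tendstoD(2)[OF ratio]) auto
    moreover have "\<forall>\<^sub>F m in sequentially. N m \<ge> 1" "\<forall>\<^sub>F m in sequentially. T m \<ge> 2 * p"
      using N T by (auto simp: filterlim_at_top)
    ultimately show ?thesis
    proof eventually_elim
      case (elim m)
      have pos: "0 < real (N m)" "0 < real (T m)" "0 < real (T m) - real i" "real (T m) - real i \<le> real (T m)"
        using elim(3) Tp[of m] i by auto
      show ?case
      proof (intro allI impI)
        fix \<epsilon> :: real assume \<epsilon>: "0 < \<epsilon> \<and> \<epsilon> \<le> \<epsilon>\<^sub>0"
        define \<theta> where "\<theta> = min \<delta>\<^sub>0 (\<epsilon> / C)"
        have \<theta>: "0 < \<theta>" "\<theta> \<le> \<delta>\<^sub>0" using \<delta>\<^sub>0 \<epsilon> C by (auto simp: \<theta>_def)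
        have "C * \<theta> \<le> C * (\<epsilon> / C)" using C by (intro mult_left_mono) (auto simp: \<theta>_def)
        then have C\<theta>: "C * \<theta> \<le> \<epsilon>" using C by simp
        let ?S = "\<Sum>k=-int p..int p. \<P>(\<omega> in M. \<theta> \<le> err_bound (N m) (T m) b k \<omega>)"
        have S: "?S \<le> K'' / (\<epsilon>\<^sup>2 * real (N m) * real (T m))"
        proof (cases "\<epsilon> / C \<le> \<delta>\<^sub>0")
          case True
          then have "\<theta> = \<epsilon> / C" by (simp add: \<theta>_def)
          then have "?S \<le> L * (A / (real (N m) * real (T m)) / (\<epsilon> / C)\<^sup>2)"
            using tail2[OF elim(3) Tp _ \<theta>(1)] elim(2) by simp
          also have "\<dots> = (L * C\<^sup>2 * A) / (\<epsilon>\<^sup>2 * real (N m) * real (T m))"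
            using C \<epsilon> pos by (simp add: power_divide field_simps)
          also have "\<dots> \<le> K'' / (\<epsilon>\<^sup>2 * real (N m) * real (T m))"
            using pos by (intro divide_right_mono) (auto simp: K''_def)
          finally show ?thesis .
        next
          case False
          then have "\<theta> = \<delta>\<^sub>0" by (simp add: \<theta>_def)
          then have "?S \<le> L * (q (N m) (T m) / (real (N m) * real (T m)) / \<delta>\<^sub>0 ^ 4)"
            using tail4[OF elim(3) Tp _ \<theta>(1)] elim(2) by simp
          also have "\<dots> \<le> L * (\<delta>\<^sub>0 ^ 4 / (L * \<epsilon>\<^sub>0\<^sup>2) / (real (N m) * real (T m)) / \<delta>\<^sub>0 ^ 4)"
            using elim(1) nonneg(3) \<delta>\<^sub>0 by (intro mult_left_mono divide_right_mono) auto
          also have "\<dots> = 1 / (\<epsilon>\<^sub>0\<^sup>2 * (real (N m) * real (T m)))"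
            using nonneg(3) \<delta>\<^sub>0 by simp
          also have "\<dots> \<le> K'' / (\<epsilon>\<^sup>2 * (real (N m) * real (T m)))"
            using \<epsilon> pos \<open>K'' \<ge> 1\<close> by (intro frac_le mult_right_mono power_mono) auto
          finally show ?thesis by (simp add: mult.assoc)
        qed
        have S': "K'' / (\<epsilon>\<^sup>2 * real (N m) * real (T m)) \<le> K'' / (\<epsilon>\<^sup>2 * real (N m) * (real (T m) - real i))"
          using pos \<epsilon> \<open>K'' \<ge> 1\<close> by (intro divide_left_mono mult_left_mono mult_pos_pos) auto
        show "\<P>(\<omega> in M. cmod (ar_est_biased p vx vw (N m) (T m) (obs \<omega>) i - complex_of_real (a i)) > \<epsilon>)
            \<le> K'' / (\<epsilon>\<^sup>2 * real (N m) * real (T m)) \<and>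
          \<P>(\<omega> in M. cmod (ar_est_unbiased p vx vw (N m) (T m) (obs \<omega>) i - complex_of_real (a i)) > \<epsilon>)
            \<le> K'' / (\<epsilon>\<^sup>2 * real (N m) * (real (T m) - real i))"
          using tail[OF elim(3) Tp elim(4) \<theta>(2) C\<theta> i, folded b_def] S S'
          unfolding obs_def by linarith
      qed
    qed
  qed
  show ?thesis
    using main \<open>K'' \<ge> 1\<close> by (intro exI[of _ K'']) auto
qed

end
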